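(* Let $\mathscr{A}$ be the Coxeter arrangement of type $A_3$ in $V=\mathbb{K}^3$ and let $m:\mathscr{A}\to\mathbb{Z}_{\ge 0}$ be a multiplicity such that $(\mathscr{A},m+\mathbf{1})$ is supersolvable, with respect to a supersolvable filtration $\mathscr{A}_1\subset\mathscr{A}_2\subset\mathscr{A}_3=\mathscr{A}$; that is, for all $H'\in\mathscr{A}_3\setminus\mathscr{A}_2$ and $H''\in\mathscr{A}_2$, with $X=H'\cap H''$, either $\mathscr{A}_X=\{H',H''\}$ or $$(m+\mathbf{1})(H'')\ \ge\ \Bigl(\sum_{H\in\mathscr{A}_3\setminus\mathscr{A}_2,\ X\subset H}(m+\mathbf{1})(H)\Bigr)-1 .\qquad( * )$$ Then there exists an $m$-universal derivation $\theta\in D(\mathscr{A},m+\mathbf{1})$ if and only if all of the inequalities $( * )$ (one for each pair $H'\in\mathscr{A}_3\setminus\mathscr{A}_2$, $H''\in\mathscr{A}_2$ with $\mathscr{A}_X\neq\{H',H''\}$) are equalities.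
   Context: $\mathbb{K}$ is a field of characteristic zero, $S=\mathbb{K}[x,y,z]$ is the coordinate ring of $V=\mathbb{K}^3$, $\mathrm{Der}_S=S\partial_x\oplus S\partial_y\oplus S\partial_z$. The (essential) Coxeter arrangement of type $A_3$ is, up to linear change of coordinates, the set of six planes in $\mathbb{K}^3$ defined by $xyz(x-y)(y-z)(x-z)=0$ (equivalently, the essentialization of the braid arrangement $\{\ker(x_i-x_j)\}_{1\le i<j\le 4}$). For each $H\in\mathscr{A}$ fix a linear form $\alpha_H$ with $\ker\alpha_H=H$. A multiplicity is a map $m:\mathscr{A}\to\mathbb{Z}_{\ge 0}$; $\mathbf{1}$ is the multiplicity with constant value $1$. $\mathscr{A}_X=\{H\in\mathscr{A}\mid X\subset H\}$. A supersolvable filtration of an arrangement $\mathscr{A}$ of rank $r$ is a chain of subarrangements $\mathscr{A}_1\subset\mathscr{A}_2\subset\cdots\subset\mathscr{A}_r=\mathscr{A}$ with $\mathrm{rank}(\mathscr{A}_i)=i$ such that for each $i\ge 2$ and any distinct $H,H'\in\mathscr{A}_i$ there is $H''\in\mathscr{A}_{i-1}$ with $H\cap H'\subset H''$. $D(\mathscr{A},m)=\{\theta\in\mathrm{Der}_S\mid\theta(\alpha_H)\in S\alpha_H^{m(H)}\ \forall H\in\mathscr{A}\}$. A nonzero derivation $\theta$ is homogeneous of degree $k$ if every nonzero $\theta(\alpha)$, for $\alpha$ a linear form, is a homogeneous polynomial of degree $k$. For $\varphi\in\mathrm{Der}_S$ and $\theta=f_1\partial_x+f_2\partial_y+f_3\partial_z$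 put $\nabla_\varphi\theta=\varphi(f_1)\partial_x+\varphi(f_2)\partial_y+\varphi(f_3)\partial_z$. A homogeneous $\theta\in D(\mathscr{A},m+\mathbf{1})$ is $m$-universal if $\mathrm{Der}_S\to D(\mathscr{A},m)$, $\varphi\mapsto\nabla_\varphi\theta$, is an isomorphism of $S$-modules. *)

theory Defs
  imports "HOL-Analysis.Analysis" "HOL-Library.Poly_Mapping"
begin

section \<open>The polynomial ring in three variables and its derivations\<close>

text \<open>
  A monomial is its exponent vector \<open>3 \<Rightarrow>\<^sub>0 nat\<close>, a polynomial its family of coefficients; the
  product of \<open>\<Rightarrow>\<^sub>0\<close> is the convolution product.  The variables \<open>x\<close>, \<open>y\<close>, \<open>z\<close> have the indices
  \<open>1\<close>, \<open>2\<close>, \<open>3\<close> of the three-element type \<open>3\<close> (where \<open>3 = 0\<close>).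
\<close>

type_synonym 'k poly3 = "(3 \<Rightarrow>\<^sub>0 nat) \<Rightarrow>\<^sub>0 'k"

definition Var :: "3 \<Rightarrow> 'k::comm_ring_1 poly3" where
  "Var i = Poly_Mapping.single (Poly_Mapping.single i 1) 1"

definition Const :: "'k::comm_ring_1 \<Rightarrow> 'k poly3" where
  "Const c = Poly_Mapping.single 0 c"

text \<open>In the terms with exponent \<open>0\<close> at \<open>i\<close> the truncated \<open>-\<close> is harmless: their coefficient is \<open>0\<close>.\<close>

definition partial_deriv :: "3 \<Rightarrow> 'k::comm_ring_1 poly3 \<Rightarrow> 'k poly3" where
  "partial_deriv i f =
     (\<Sum>e\<in>Poly_Mapping.keys f.
        Poly_Mapping.single (e - Poly_Mapping.single i 1)
          (of_nat (Poly_Mapping.lookup e i) * Poly_Mapping.lookup f e))"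

definition homogeneous_poly :: "nat \<Rightarrow> 'k::comm_ring_1 poly3 \<Rightarrow> bool" where
  "homogeneous_poly k f \<longleftrightarrow>
     (\<forall>e\<in>Poly_Mapping.keys f. (\<Sum>i\<in>UNIV. Poly_Mapping.lookup e i) = k)"

text \<open>
  The free module \<open>S\<partial>\<^sub>x \<oplus> S\<partial>\<^sub>y \<oplus> S\<partial>\<^sub>z\<close> of derivations: \<open>\<theta> $ i\<close> is the coefficient of
  the \<open>i\<close>-th partial derivative, and the module structure is the one of \<open>S\<^sup>3\<close>, with scalar
  multiplication \<open>(*s)\<close>.
\<close>

type_synonym 'k der = "'k poly3 ^ 3"

definition der_apply :: "'k::comm_ring_1 der \<Rightarrow> 'k poly3 \<Rightarrow> 'k poly3" where
  "der_apply \<theta> f = (\<Sum>i\<in>UNIV. \<theta> $ i * partial_deriv i f)"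

definition nabla :: "'k::comm_ring_1 der \<Rightarrow> 'k der \<Rightarrow> 'k der" where
  "nabla \<phi> \<theta> = (\<chi> i. der_apply \<phi> (\<theta> $ i))"

text \<open>A linear form \<open>a\<^sub>1x + a\<^sub>2y + a\<^sub>3z\<close> is given by its coefficient vector \<open>a\<close>.\<close>

definition linform_poly :: "'k::comm_ring_1 ^ 3 \<Rightarrow> 'k poly3" where
  "linform_poly a = (\<Sum>i\<in>UNIV. Const (a $ i) * Var i)"

definition linform_ker :: "'k::comm_ring_1 ^ 3 \<Rightarrow> ('k ^ 3) set" where
  "linform_ker a = {v. (\<Sum>i\<in>UNIV. a $ i * v $ i) = 0}"

definition homogeneous_der :: "nat \<Rightarrow> 'k::comm_ring_1 der \<Rightarrow> bool" where
  "homogeneous_der k \<theta> \<longleftrightarrow>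
     \<theta> \<noteq> 0 \<and>
     (\<forall>a. der_apply \<theta> (linform_poly a) \<noteq> 0 \<longrightarrow>
          homogeneous_poly k (der_apply \<theta> (linform_poly a)))"

section \<open>Arrangements\<close>

type_synonym 'k arrangement = "('k ^ 3) set set"

definition A3_standard :: "'k::field arrangement" where
  "A3_standard =
     {{v. v $ 1 = 0}, {v. v $ 2 = 0}, {v. v $ 3 = 0},
      {v. v $ 1 = v $ 2}, {v. v $ 2 = v $ 3}, {v. v $ 1 = v $ 3}}"

definition type_A3 :: "'k::field arrangement \<Rightarrow> bool" where
  "type_A3 \<A> \<longleftrightarrow>
     (\<exists>M :: 'k ^ 3 ^ 3. invertible M \<and> \<A> = (\<lambda>H. (\<lambda>v. M *v v) ` H) ` A3_standard)"

definition localization :: "'k::field arrangement \<Rightarrow> ('k ^ 3) set \<Rightarrow> 'k arrangement" where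
  "localization \<A> X = {H \<in> \<A>. X \<subseteq> H}"

definition arr_rank :: "'k::field arrangement \<Rightarrow> nat" where
  "arr_rank \<A> = vec.dim (UNIV :: ('k ^ 3) set) - vec.dim (\<Inter>\<A>)"

text \<open>Only \<open>F 1, \<dots>, F r\<close> matter.\<close>

definition supersolvable_filtration ::
    "'k::field arrangement \<Rightarrow> nat \<Rightarrow> (nat \<Rightarrow> 'k arrangement) \<Rightarrow> bool" where
  "supersolvable_filtration \<A> r F \<longleftrightarrow>
     arr_rank \<A> = r \<and> F r = \<A> \<and>
     (\<forall>i\<in>{1..<r}. F i \<subset> F (Suc i)) \<and>
     (\<forall>i\<in>{1..r}. arr_rank (F i) = i) \<and>
     (\<forall>i\<in>{2..r}. \<forall>H\<in>F i. \<forall>H'\<in>F i. H \<noteq> H' \<longrightarrow> (\<exists>H''\<in>F (i - 1). H \<inter> H' \<subseteq> H''))"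

section \<open>Multiarrangements and universal derivations\<close>

text \<open>
  Multiplicities are functions on all sets; only their values on \<open>\<A>\<close> matter.  The
  parameter \<open>\<alpha>\<close> is the choice of a defining linear form for every plane of \<open>\<A>\<close>.
\<close>

definition defining_forms ::
    "'k::field arrangement \<Rightarrow> (('k ^ 3) set \<Rightarrow> 'k ^ 3) \<Rightarrow> bool" where
  "defining_forms \<A> \<alpha> \<longleftrightarrow> (\<forall>H\<in>\<A>. linform_ker (\<alpha> H) = H)"

definition log_der ::
    "'k::field arrangement \<Rightarrow> (('k ^ 3) set \<Rightarrow> 'k ^ 3) \<Rightarrow> (('k ^ 3) set \<Rightarrow> nat) \<Rightarrow> 'k der set" where
  "log_der \<A> \<alpha> m =
     {\<theta>. \<forall>H\<in>\<A>. linform_poly (\<alpha> H) ^ m H dvd der_apply \<theta> (linform_poly (\<alpha> H))}"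

definition universal_der ::
    "'k::field arrangement \<Rightarrow> (('k ^ 3) set \<Rightarrow> 'k ^ 3) \<Rightarrow> (('k ^ 3) set \<Rightarrow> nat) \<Rightarrow> 'k der \<Rightarrow> bool" where
  "universal_der \<A> \<alpha> m \<theta> \<longleftrightarrow>
     \<theta> \<in> log_der \<A> \<alpha> (\<lambda>H. m H + 1) \<and>
     (\<exists>k. homogeneous_der k \<theta>) \<and>
     module_hom (*s) (*s) (\<lambda>\<phi>. nabla \<phi> \<theta>) \<and>
     bij_betw (\<lambda>\<phi>. nabla \<phi> \<theta>) UNIV (log_der \<A> \<alpha> m)"

end

theory Submission
  imports Defs
begin

text \<open>
  Write \<open>L\<^sub>1, L\<^sub>2, L\<^sub>3\<close> for linear forms such that the coatom \<open>F 2\<close> consists of the planes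
  \<open>L\<^sub>i = L\<^sub>j\<close> and the other three planes are \<open>L\<^sub>i = 0\<close>; let \<open>a\<^sub>i\<close> and \<open>b\<^sub>i\<^sub>j\<close> be the values of \<open>m\<close> on
  \<open>L\<^sub>i = 0\<close> and \<open>L\<^sub>i = L\<^sub>j\<close>.  Such coordinates exist for every supersolvable filtration, because its
  coatom has rank two and must contain a plane through each double line, and hence is one of the
  four triples of planes with a common line (\<open>supersolvable_obtain_coordinates\<close>).  The inequalities say
  \<open>b\<^sub>i\<^sub>j \<ge> a\<^sub>i + a\<^sub>j\<close>.  Describing a derivation \<open>\<theta>\<close> by its values \<open>f\<^sub>i = \<theta>(L\<^sub>i)\<close>, the map
  \<open>\<phi> \<mapsto> \<nabla>\<^sub>\<phi>\<theta>\<close> becomes multiplication by the Jacobian matrix of \<open>f\<close> with respect to the \<open>L\<^sub>i\<close>.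

  Necessity (\<open>equalities_if_generators\<close>) is a count of degrees.  If \<open>\<theta>\<close> is \<open>m\<close>-universal of degree
  \<open>n\<close>, the entries of the Jacobian matrix have degree \<open>n - 1\<close>.  Its determinant is nonzero and
  divisible by the defining polynomial of the multiarrangement, so \<open>\<Sum> a\<^sub>i + \<Sum> b\<^sub>i\<^sub>j \<le> 3 (n - 1)\<close>.  On
  the other hand the derivation with all values \<open>L\<^sub>1\<^sup>a\<^sup>1 L\<^sub>2\<^sup>a\<^sup>2 L\<^sub>3\<^sup>a\<^sup>3\<close> is logarithmic, hence a
  combination of the columns, so \<open>n - 1 \<le> \<Sum> a\<^sub>i\<close>.  Together with \<open>b\<^sub>i\<^sub>j \<ge> a\<^sub>i + a\<^sub>j\<close> this forces
  equality everywhere.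

  For sufficiency a universal derivation is given by the integrals
  \<open>f\<^sub>i = \<integral> (t - L\<^sub>1)\<^sup>a\<^sup>1 (t - L\<^sub>2)\<^sup>a\<^sup>2 (t - L\<^sub>3)\<^sup>a\<^sup>3 dt\<close> from \<open>0\<close> to \<open>L\<^sub>i\<close>.  The zeros of the integrand
  at the endpoints make \<open>f\<^sub>i\<close> divisible by \<open>L\<^sub>i\<close> to the power \<open>a\<^sub>i + 1\<close> and \<open>f\<^sub>i - f\<^sub>j\<close> divisible by
  \<open>L\<^sub>i - L\<^sub>j\<close> to the power \<open>a\<^sub>i + a\<^sub>j + 1\<close> (\<open>integ_endpoint_zeros\<close>).  The degrees are such that the
  Jacobian determinant is a scalar multiple of the defining polynomial; the scalar is not zero,
  because the leading terms of \<open>f\<^sub>1, f\<^sub>2, f\<^sub>3\<close>, in which beta integrals appear, have independent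
  exponents (\<open>det_jacobian_nonzero\<close>).  Saito's criterion (\<open>saito_criterion\<close>) then shows that
  the Jacobian matrix maps isomorphically onto the logarithmic derivations.
\<close>

section \<open>Polynomials in three variables\<close>

lemma poly3_induct_add:
  fixes f :: "'k::comm_ring_1 poly3"
  assumes single: "\<And>e c. P (Poly_Mapping.single e c)"
    and add: "\<And>f g. P f \<Longrightarrow> P g \<Longrightarrow> P (f + g)"
  shows "P f"
proof (induction f rule: update_induct)
  case const
  show ?case using single[of 0 0] by simp
next
  case (update f a b)
  have "Poly_Mapping.update a b f = f + Poly_Mapping.single a b"
    using update(1)
    by (intro poly_mapping_eqI) (auto simp: lookup_update lookup_add lookup_single not_in_keys_iff_lookup_eq_zero)
  then show ?case using add[OF update(3) single] by simp
qed

lemma Const_0 [simp]: "Const 0 = 0"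
  and Const_1 [simp]: "Const 1 = 1"
  by (simp_all add: Const_def)

lemma Const_add: "Const (a + b) = Const a + Const b"
  and Const_diff: "Const (a - b) = Const a - Const b"
  and Const_minus: "Const (- a) = - Const a"
  and Const_mult: "Const (a * b) = Const a * Const b"
  by (simp_all add: Const_def single_add single_diff single_uminus mult_single)

lemma Const_sum: "Const (\<Sum>i\<in>I. g i) = (\<Sum>i\<in>I. Const (g i))"
  by (induction I rule: infinite_finite_induct) (simp_all add: Const_add)

lemma Const_power: "Const (a ^ n) = Const a ^ n"
  by (induction n) (simp_all add: Const_mult)

lemma Const_of_nat: "Const (of_nat n) = of_nat n"
  by (induction n) (simp_all add: Const_add)

lemma Const_eq_0_iff [simp]: "Const c = 0 \<longleftrightarrow> c = 0"
  by (metis Const_0 Const_def lookup_single_eq lookup_zero)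

lemma Const_inverse_cancel:
  fixes c :: "'k::field"
  assumes "c \<noteq> 0" shows "Const c * Const (inverse c) = 1"
  using assms by (simp flip: Const_mult)

lemma Const_inverse_cancel_left:
  fixes c :: "'k::field"
  assumes "c \<noteq> 0" shows "Const (inverse c) * (Const c * f) = f"
proof -
  have "Const (inverse c) * (Const c * f) = Const c * Const (inverse c) * f"
    by (simp only: mult_ac)
  then show ?thesis unfolding Const_inverse_cancel[OF assms] by simp
qed

lemma Var_power: "Var i ^ n = Poly_Mapping.single (Poly_Mapping.single i n) (1::'k::comm_ring_1)"
  by (induction n) (simp_all add: Var_def mult_single flip: single_add)

lemma prod_UNIV_3: "prod f (UNIV :: 3 set) = f 1 * f 2 * f 3"
  unfolding UNIV_3 by (simp add: mult_ac)

lemma single_eq_monomial: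
  "Poly_Mapping.single e c = Const c * (\<Prod>i\<in>UNIV. Var i ^ Poly_Mapping.lookup e i)"
proof -
  have e: "e = Poly_Mapping.single 1 (Poly_Mapping.lookup e 1)
      + Poly_Mapping.single 2 (Poly_Mapping.lookup e 2) + Poly_Mapping.single 3 (Poly_Mapping.lookup e 3)"
    by (intro poly_mapping_eqI)
      (use exhaust_3 in \<open>fastforce simp: lookup_add lookup_single when_def\<close>)
  show ?thesis
    by (subst e) (simp add: Const_def prod_UNIV_3 Var_power mult_single add.assoc)
qed

lemma poly3_induct [case_names Const Var add mult]:
  fixes f :: "'k::comm_ring_1 poly3"
  assumes "\<And>c. P (Const c)" and "\<And>i. P (Var i)"
    and "\<And>f g. P f \<Longrightarrow> P g \<Longrightarrow> P (f + g)" and "\<And>f g. P f \<Longrightarrow> P g \<Longrightarrow> P (f * g)"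
  shows "P f"
proof (induction f rule: poly3_induct_add)
  case (1 e c)
  have pow: "P (f ^ n)" if "P f" for f n
    using that assms(1)[of 1] assms(4) by (induction n) simp_all
  then show ?case
    unfolding single_eq_monomial prod_UNIV_3 by (intro assms pow)
qed (use assms in blast)

subsection \<open>Partial derivatives\<close>

lemma partial_deriv_single:
  "partial_deriv i (Poly_Mapping.single e c)
     = Poly_Mapping.single (e - Poly_Mapping.single i 1) (of_nat (Poly_Mapping.lookup e i) * c)"
  by (simp add: partial_deriv_def)

lemma partial_deriv_add: "partial_deriv i (f + g) = partial_deriv i f + partial_deriv i g"
  unfolding partial_deriv_def
  by (rule setsum_keys_plus_distrib) (simp_all add: distrib_left single_add)

lemma partial_deriv_mult_single:
  "partial_deriv i (Poly_Mapping.single e c * Poly_Mapping.single e' c')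
     = partial_deriv i (Poly_Mapping.single e c) * Poly_Mapping.single e' c'
       + Poly_Mapping.single e c * partial_deriv i (Poly_Mapping.single e' c')"
    (is "?l = ?r1 + ?r2")
proof -
  let ?n = "Poly_Mapping.lookup e i" and ?n' = "Poly_Mapping.lookup e' i"
  let ?s = "e + e' - Poly_Mapping.single i 1"
  have "?r1 = Poly_Mapping.single ?s (of_nat ?n * c * c')"
  proof (cases "?n = 0")
    case False
    then have "e - Poly_Mapping.single i 1 + e' = ?s"
      by (intro poly_mapping_eqI) (auto simp: lookup_add lookup_minus lookup_single when_def)
    then show ?thesis by (simp add: partial_deriv_single mult_single)
  qed (simp add: partial_deriv_single)
  moreover have "?r2 = Poly_Mapping.single ?s (of_nat ?n' * c * c')"
  proof (cases "?n' = 0")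
    case False
    then have "e + (e' - Poly_Mapping.single i 1) = ?s"
      by (intro poly_mapping_eqI) (auto simp: lookup_add lookup_minus lookup_single when_def)
    then show ?thesis by (simp add: partial_deriv_single mult_single mult_ac)
  qed (simp add: partial_deriv_single)
  ultimately show ?thesis
    by (simp add: mult_single partial_deriv_single lookup_add algebra_simps flip: single_add)
qed

lemma partial_deriv_mult:
  "partial_deriv i (f * g) = partial_deriv i f * g + f * partial_deriv i g"
proof (induction f rule: poly3_induct_add)
  case (1 e c)
  show ?case
    by (induction g rule: poly3_induct_add)
      (simp_all only: partial_deriv_mult_single partial_deriv_add distrib_left add_ac)
next
  case (2 f f')
  then show ?case by (simp only: partial_deriv_add distrib_right add_ac)
qed

lemma partial_deriv_Const [simp]: "partial_deriv i (Const c) = 0"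
  by (simp add: Const_def partial_deriv_single)

lemma partial_deriv_Var: "partial_deriv i (Var j) = (if i = j then 1 else 0)"
  by (auto simp: Var_def partial_deriv_single lookup_single when_def)

lemma partial_deriv_0 [simp]: "partial_deriv i 0 = 0"
  using partial_deriv_Const[of i 0] by simp

lemma der_apply_add: "der_apply \<phi> (f + g) = der_apply \<phi> f + der_apply \<phi> g"
  by (simp add: der_apply_def partial_deriv_add distrib_left sum.distrib)

lemma der_apply_mult: "der_apply \<phi> (f * g) = der_apply \<phi> f * g + f * der_apply \<phi> g"
  by (simp add: der_apply_def partial_deriv_mult algebra_simps sum.distrib sum_distrib_left)

lemma der_apply_Const [simp]: "der_apply \<phi> (Const c) = 0"
  by (simp add: der_apply_def)

lemma der_apply_0 [simp]: "der_apply \<phi> 0 = 0"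
  by (simp add: der_apply_def)

lemma der_apply_Var: "der_apply \<phi> (Var j) = \<phi> $ j"
  by (simp add: der_apply_def partial_deriv_Var if_distrib cong: if_cong)

lemma der_apply_sum: "der_apply \<phi> (\<Sum>i\<in>I. f i) = (\<Sum>i\<in>I. der_apply \<phi> (f i))"
  by (induction I rule: infinite_finite_induct) (simp_all add: der_apply_add)

lemma der_apply_minus: "der_apply \<phi> (- f) = - der_apply \<phi> f"
  using der_apply_add[of \<phi> f "- f"] by (simp add: eq_neg_iff_add_eq_0 add.commute)

lemma der_apply_diff: "der_apply \<phi> (f - g) = der_apply \<phi> f - der_apply \<phi> g"
  using der_apply_add[of \<phi> f "- g"] by (simp add: der_apply_minus)

lemma der_apply_power_Suc: "der_apply \<phi> (f ^ Suc n) = of_nat (Suc n) * f ^ n * der_apply \<phi> f"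
  by (induction n) (simp_all add: der_apply_mult algebra_simps)

lemma der_apply_linform: "der_apply \<phi> (linform_poly a) = (\<Sum>i\<in>UNIV. Const (a $ i) * \<phi> $ i)"
  by (simp add: linform_poly_def der_apply_sum der_apply_mult der_apply_Var)

lemma power_dvd_der_apply:
  assumes "p ^ Suc n dvd f" shows "p ^ n dvd der_apply \<phi> f"
proof -
  obtain g where "f = p ^ Suc n * g" using assms by blast
  then have "der_apply \<phi> f = p ^ n * (of_nat (Suc n) * der_apply \<phi> p * g + p * der_apply \<phi> g)"
    by (simp only: der_apply_mult der_apply_power_Suc) (simp add: algebra_simps)
  then show ?thesis by simp
qed

subsection \<open>Homogeneous polynomials\<close>

lemma homogeneous_poly_0 [simp]: "homogeneous_poly n 0"
  by (simp add: homogeneous_poly_def)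

lemma homogeneous_poly_add:
  "homogeneous_poly n f \<Longrightarrow> homogeneous_poly n g \<Longrightarrow> homogeneous_poly n (f + g)"
  unfolding homogeneous_poly_def using keys_add[of f g] by blast

lemma homogeneous_poly_minus: "homogeneous_poly n f \<Longrightarrow> homogeneous_poly n (- f)"
  unfolding homogeneous_poly_def by (simp add: keys_def)

lemma homogeneous_poly_diff:
  "homogeneous_poly n f \<Longrightarrow> homogeneous_poly n g \<Longrightarrow> homogeneous_poly n (f - g)"
  using homogeneous_poly_add[of n f "- g"] by (simp add: homogeneous_poly_minus)

lemma homogeneous_poly_mult:
  assumes "homogeneous_poly n f" "homogeneous_poly k g" shows "homogeneous_poly (n + k) (f * g)"
  unfolding homogeneous_poly_def
proof
  fix e assume "e \<in> Poly_Mapping.keys (f * g)"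
  then obtain a b where "e = a + b" "a \<in> Poly_Mapping.keys f" "b \<in> Poly_Mapping.keys g"
    using keys_mult[of f g] by blast
  then show "(\<Sum>i\<in>UNIV. Poly_Mapping.lookup e i) = n + k"
    using assms by (simp add: homogeneous_poly_def lookup_add sum.distrib)
qed

lemma homogeneous_poly_sum:
  "(\<And>i. i \<in> I \<Longrightarrow> homogeneous_poly n (f i)) \<Longrightarrow> homogeneous_poly n (\<Sum>i\<in>I. f i)"
  by (induction I rule: infinite_finite_induct) (simp_all add: homogeneous_poly_add)

lemma homogeneous_poly_Const: "homogeneous_poly 0 (Const c)"
  by (simp add: homogeneous_poly_def Const_def)

lemma homogeneous_poly_Const_mult: "homogeneous_poly n f \<Longrightarrow> homogeneous_poly n (Const c * f)"
  using homogeneous_poly_mult[OF homogeneous_poly_Const] by fastforce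

lemma homogeneous_poly_power: "homogeneous_poly n f \<Longrightarrow> homogeneous_poly (n * k) (f ^ k)"
proof (induction k)
  case 0
  show ?case using homogeneous_poly_Const[of 1] by simp
next
  case (Suc k)
  then show ?case using homogeneous_poly_mult[of n f "n * k" "f ^ k"] by simp
qed

lemma homogeneous_poly_linform: "homogeneous_poly 1 (linform_poly a)"
  unfolding linform_poly_def
  by (intro homogeneous_poly_sum homogeneous_poly_Const_mult)
    (simp add: homogeneous_poly_def Var_def lookup_single when_def)

lemma homogeneous_poly_partial_deriv:
  assumes "homogeneous_poly n f" shows "homogeneous_poly (n - 1) (partial_deriv i f)"
  unfolding partial_deriv_def
proof (rule homogeneous_poly_sum)
  fix e assume "e \<in> Poly_Mapping.keys f"
  then have n: "(\<Sum>j\<in>UNIV. Poly_Mapping.lookup e j) = n"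
    using assms by (simp add: homogeneous_poly_def)
  show "homogeneous_poly (n - 1) (Poly_Mapping.single (e - Poly_Mapping.single i 1)
      (of_nat (Poly_Mapping.lookup e i) * Poly_Mapping.lookup f e))"
  proof (cases "Poly_Mapping.lookup e i = 0")
    case False
    then show ?thesis
      using n exhaust_3[of i]
      by (auto simp: homogeneous_poly_def lookup_minus lookup_single when_def sum_3)
  qed simp
qed

text \<open>
  A nonzero homogeneous combination of homogeneous polynomials of degree \<open>n\<close>, with arbitrary
  coefficients, has degree at least \<open>n\<close>.
\<close>

lemma homogeneous_combination_degree:
  fixes p \<psi> :: "'i \<Rightarrow> 'k::comm_ring_1 poly3"
  assumes "\<And>i. i \<in> I \<Longrightarrow> homogeneous_poly n (p i)"
    and "homogeneous_poly d g" "g \<noteq> 0" and g: "g = (\<Sum>i\<in>I. \<psi> i * p i)"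
  shows "n \<le> d"
proof -
  let ?S = "{f::'k poly3. \<forall>e\<in>Poly_Mapping.keys f. n \<le> (\<Sum>i\<in>UNIV. Poly_Mapping.lookup e i)}"
  have "\<psi> i * p i \<in> ?S" if "i \<in> I" for i
    using keys_mult[of "\<psi> i" "p i"] assms(1)[OF that]
    by (fastforce simp: homogeneous_poly_def lookup_add sum.distrib)
  then have "(\<Sum>i\<in>I. \<psi> i * p i) \<in> ?S"
  proof (induction I rule: infinite_finite_induct)
    case (insert i I)
    then show ?case using keys_add[of "\<psi> i * p i" "\<Sum>i\<in>I. \<psi> i * p i"] by fastforce
  qed simp_all
  moreover obtain e where "e \<in> Poly_Mapping.keys g" using \<open>g \<noteq> 0\<close> by fastforce
  ultimately show ?thesis using assms(2) g by (auto simp: homogeneous_poly_def)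
qed

text \<open>A factor of degree zero is a scalar.\<close>

lemma homogeneous_quotient_Const:
  fixes q c :: "'k::field poly3"
  assumes "homogeneous_poly n q" "homogeneous_poly n (q * c)" "q \<noteq> 0"
  obtains c0 where "c = Const c0"
proof -
  define c0 where "c0 = Poly_Mapping.lookup c 0"
  define c' where "c' = c - Const c0"
  have deg0: "e = 0" if "(\<Sum>i\<in>UNIV. Poly_Mapping.lookup e i) = 0" for e :: "3 \<Rightarrow>\<^sub>0 nat"
    using that by (intro poly_mapping_eqI) simp
  have hom: "homogeneous_poly n (q * c')"
    unfolding c'_def right_diff_distrib
    using assms homogeneous_poly_Const_mult[OF assms(1)] by (simp add: homogeneous_poly_diff mult.commute)
  have "q * c' = 0"
  proof (rule ccontr)
    assume "q * c' \<noteq> 0"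
    then obtain e where e: "e \<in> Poly_Mapping.keys (q * c')" by fastforce
    then obtain a b where ab: "e = a + b" "a \<in> Poly_Mapping.keys q" "b \<in> Poly_Mapping.keys c'"
      using keys_mult[of q c'] by blast
    have "(\<Sum>i\<in>UNIV. Poly_Mapping.lookup e i) = n" "(\<Sum>i\<in>UNIV. Poly_Mapping.lookup a i) = n"
      using e hom assms(1) ab(2) unfolding homogeneous_poly_def by blast+
    then have "(\<Sum>i\<in>UNIV. Poly_Mapping.lookup b i) = 0"
      unfolding ab(1) lookup_add sum.distrib by linarith
    then have "b = 0" by (rule deg0)
    then show False
      using ab(3) by (simp add: c'_def c0_def Const_def in_keys_iff lookup_minus lookup_single)
  qed
  then have "c = Const c0" using assms(3) by (simp add: c'_def)
  then show thesis by (rule that)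
qed

subsection \<open>Linear forms are prime\<close>

text \<open>The algebra endomorphism that sends the variable with index \<open>i\<close> to \<open>g i\<close>.\<close>

definition subst_poly :: "(3 \<Rightarrow> 'k::comm_ring_1 poly3) \<Rightarrow> 'k poly3 \<Rightarrow> 'k poly3" where
  "subst_poly g f =
     (\<Sum>e\<in>Poly_Mapping.keys f. Const (Poly_Mapping.lookup f e) * (\<Prod>i\<in>UNIV. g i ^ Poly_Mapping.lookup e i))"

lemma subst_poly_single:
  "subst_poly g (Poly_Mapping.single e c) = Const c * (\<Prod>i\<in>UNIV. g i ^ Poly_Mapping.lookup e i)"
  by (simp add: subst_poly_def)

lemma subst_poly_add: "subst_poly g (f + f') = subst_poly g f + subst_poly g f'"
  unfolding subst_poly_def
  by (rule setsum_keys_plus_distrib) (simp_all add: distrib_right Const_add)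

lemma subst_poly_mult: "subst_poly g (f * f') = subst_poly g f * subst_poly g f'"
proof (induction f rule: poly3_induct_add)
  case (1 e c)
  show ?case
    by (induction f' rule: poly3_induct_add)
      (simp_all add: mult_single subst_poly_single subst_poly_add lookup_add power_add prod.distrib
        Const_mult algebra_simps)
qed (simp add: distrib_right subst_poly_add)

lemma subst_poly_Const [simp]: "subst_poly g (Const c) = Const c"
  by (simp add: Const_def subst_poly_single)

lemma subst_poly_Var [simp]: "subst_poly g (Var i) = g i"
  by (simp add: Var_def subst_poly_single lookup_single when_def if_distrib[of "\<lambda>n. _ ^ n"] prod.delta cong: if_cong)

lemma subst_poly_0 [simp]: "subst_poly g 0 = 0"
  using subst_poly_Const[of g 0] by simp

lemma subst_poly_power: "subst_poly g (f ^ n) = subst_poly g f ^ n"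
  using subst_poly_Const[of g 1] by (induction n) (simp_all add: subst_poly_mult)

lemma subst_poly_sum: "subst_poly g (\<Sum>i\<in>I. f i) = (\<Sum>i\<in>I. subst_poly g (f i))"
  by (induction I rule: infinite_finite_induct) (simp_all add: subst_poly_add)

lemma subst_poly_linform: "subst_poly g (linform_poly a) = (\<Sum>i\<in>UNIV. Const (a $ i) * g i)"
  by (simp add: linform_poly_def subst_poly_sum subst_poly_mult)

lemma linform_poly_diff: "linform_poly (a - b) = linform_poly a - linform_poly b"
  by (simp add: linform_poly_def Const_diff left_diff_distrib sum_subtractf)

lemma linform_poly_scale: "linform_poly (c *s a) = Const c * linform_poly a"
  by (simp add: linform_poly_def Const_mult sum_distrib_left mult_ac)

lemma linform_poly_eq_0_iff [simp]: "linform_poly a = 0 \<longleftrightarrow> a = 0"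
proof
  assume "linform_poly a = 0"
  then have "partial_deriv i (linform_poly a) = 0" for i by simp
  moreover have "partial_deriv i (linform_poly a) = Const (a $ i)" for i
    using exhaust_3[of i]
    by (auto simp: linform_poly_def sum_3 partial_deriv_add partial_deriv_mult partial_deriv_Var)
  ultimately show "a = 0" by (simp add: vec_eq_iff)
qed (simp add: linform_poly_def)

text \<open>
  If \<open>a \<bullet> v = 1\<close>, the projection of the ambient space along \<open>v\<close> onto the plane \<open>a = 0\<close> induces the
  following endomorphism of the polynomial ring, whose kernel is generated by the linear form \<open>a\<close>.
\<close>

definition plane_proj :: "'k::comm_ring_1 ^ 3 \<Rightarrow> 'k ^ 3 \<Rightarrow> 'k poly3 \<Rightarrow> 'k poly3" where
  "plane_proj a v = subst_poly (\<lambda>i. Var i - Const (v $ i) * linform_poly a)"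

lemmas plane_proj_simps =
  subst_poly_add[of "\<lambda>i. Var i - Const (v $ i) * linform_poly a" for a v, folded plane_proj_def]
  subst_poly_mult[of "\<lambda>i. Var i - Const (v $ i) * linform_poly a" for a v, folded plane_proj_def]
  subst_poly_power[of "\<lambda>i. Var i - Const (v $ i) * linform_poly a" for a v, folded plane_proj_def]
  subst_poly_Const[of "\<lambda>i. Var i - Const (v $ i) * linform_poly a" for a v, folded plane_proj_def]

lemma plane_proj_linform:
  "plane_proj a v (linform_poly b) = linform_poly (b - (\<Sum>i\<in>UNIV. b $ i * v $ i) *s a)"
  by (simp add: plane_proj_def subst_poly_linform linform_poly_diff linform_poly_scale
      right_diff_distrib sum_subtractf Const_sum Const_mult sum_distrib_right mult.assoc)
    (simp add: linform_poly_def)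

lemma linform_dvd_iff_plane_proj:
  assumes "(\<Sum>i\<in>UNIV. a $ i * v $ i) = 1"
  shows "linform_poly a dvd f \<longleftrightarrow> plane_proj a v f = 0"
proof
  assume "linform_poly a dvd f"
  moreover have "plane_proj a v (linform_poly a) = 0"
    by (simp add: plane_proj_linform assms)
  ultimately show "plane_proj a v f = 0" by (auto simp: plane_proj_simps)
next
  \<comment> \<open>The endomorphism is the identity modulo the linear form, since it is so on the variables.\<close>
  have "linform_poly a dvd f - plane_proj a v f"
  proof (induction f rule: poly3_induct)
    case (mult f g)
    have "f * g - plane_proj a v (f * g)
        = (f - plane_proj a v f) * g + plane_proj a v f * (g - plane_proj a v g)"
      by (simp add: plane_proj_simps algebra_simps)
    then show ?case using mult by simp
  next
    case (add f g)
    then show ?case using dvd_add[OF add] by (simp add: plane_proj_simps algebra_simps)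
  qed (simp_all add: plane_proj_def)
  moreover assume "plane_proj a v f = 0"
  ultimately show "linform_poly a dvd f" by simp
qed

lemma obtain_dual_vector:
  fixes a :: "'k::field ^ 3"
  assumes "a \<noteq> 0" obtains v where "(\<Sum>i\<in>UNIV. a $ i * v $ i) = 1"
proof -
  obtain j where "a $ j \<noteq> 0" using assms by (auto simp: vec_eq_iff)
  then have "(\<Sum>i\<in>UNIV. a $ i * axis j (inverse (a $ j)) $ i) = 1"
    by (simp add: axis_def if_distrib cong: if_cong)
  then show thesis by (rule that)
qed

text \<open>
  The linear form generates the kernel of an endomorphism of an integral domain.
\<close>

lemma prime_elem_linform:
  fixes a :: "'k::field ^ 3"
  assumes "a \<noteq> 0" shows "prime_elem (linform_poly a)"
proof -
  obtain v where v: "(\<Sum>i\<in>UNIV. a $ i * v $ i) = 1" using obtain_dual_vector assms by metis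
  have "plane_proj a v 1 = 1" using subst_poly_Const[of _ 1] by (simp add: plane_proj_def)
  then show ?thesis
    using assms by (auto simp: prime_elem_def linform_dvd_iff_plane_proj[OF v] plane_proj_simps)
qed

lemma linform_dvd_linformD:
  fixes a b :: "'k::field ^ 3"
  assumes "a \<noteq> 0" "linform_poly a dvd linform_poly b" obtains c where "b = c *s a"
proof -
  obtain v where v: "(\<Sum>i\<in>UNIV. a $ i * v $ i) = 1" using obtain_dual_vector assms by metis
  have "b = (\<Sum>i\<in>UNIV. b $ i * v $ i) *s a"
    using assms(2) by (simp add: linform_dvd_iff_plane_proj[OF v] plane_proj_linform)
  then show thesis by (rule that)
qed

lemma prime_elem_power_dvd_mult:
  fixes p :: "'a::idom"
  assumes "prime_elem p" "\<not> p dvd a" "p ^ n dvd a * b" shows "p ^ n dvd b"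
  using assms(3)
proof (induction n arbitrary: b)
  case (Suc n)
  then have "p dvd a * b" by (meson dvd_trans dvd_power zero_less_Suc)
  then obtain b' where b': "b = p * b'" using assms(1,2) unfolding prime_elem_def by blast
  have "p * p ^ n dvd p * (a * b')" using Suc.prems by (simp add: b' mult_ac)
  moreover have "p \<noteq> 0" using assms(1) by auto
  ultimately have "p ^ n dvd a * b'" by (simp only: dvd_mult_cancel_left) simp
  then have "p ^ n dvd b'" by (rule Suc.IH)
  then show ?case unfolding b' power_Suc by (rule mult_dvd_mono[OF dvd_refl])
qed simp

lemma prime_elem_power_mult_dvd:
  fixes p :: "'a::idom"
  assumes "prime_elem p" "\<not> p dvd q" "q dvd f" "p ^ n dvd f" shows "q * p ^ n dvd f"
proof -
  obtain g where g: "f = q * g" using assms(3) by blast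
  then have "p ^ n dvd q * g" using assms(4) by simp
  then have "p ^ n dvd g" by (rule prime_elem_power_dvd_mult[OF assms(1,2)])
  then show ?thesis unfolding g by (rule mult_dvd_mono[OF dvd_refl])
qed

section \<open>Integration of univariate polynomials\<close>

text \<open>
  The antiderivative with value \<open>0\<close> at \<open>0\<close> of a polynomial in a new variable, with
  coefficients in the polynomial ring in three variables.
\<close>

definition integ :: "'k::field_char_0 poly3 poly \<Rightarrow> 'k poly3 poly" where
  "integ p = (\<Sum>n\<le>degree p. monom (Const (inverse (of_nat (Suc n))) * coeff p n) (Suc n))"

lemma coeff_integ_0 [simp]: "coeff (integ p) 0 = 0"
  by (simp add: integ_def coeff_sum)

lemma coeff_integ_Suc: "coeff (integ p) (Suc n) = Const (inverse (of_nat (Suc n))) * coeff p n"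
  by (cases "n \<le> degree p")
    (simp_all add: integ_def coeff_sum coeff_eq_0 del: of_nat_Suc)

lemma integ_add: "integ (p + q) = integ p + integ q"
proof (rule poly_eqI)
  show "coeff (integ (p + q)) n = coeff (integ p + integ q) n" for n
    by (cases n) (simp_all add: coeff_integ_Suc distrib_left)
qed

lemma integ_smult: "integ (smult c p) = smult c (integ p)"
proof (rule poly_eqI)
  show "coeff (integ (smult c p)) n = coeff (smult c (integ p)) n" for n
    by (cases n) (simp_all add: coeff_integ_Suc mult_ac)
qed

lemma poly_integ_0 [simp]: "poly (integ p) 0 = 0"
  by (simp add: poly_0_coeff_0)

lemma pderiv_integ: "pderiv (integ p) = p"
proof (rule poly_eqI)
  fix n
  have "of_nat (Suc n) * Const (inverse (of_nat (Suc n))) = (1 :: 'a poly3)"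
    using Const_inverse_cancel[of "of_nat (Suc n) :: 'a"] by (simp add: Const_of_nat del: of_nat_Suc)
  then show "coeff (pderiv (integ p)) n = coeff p n"
    by (simp add: coeff_pderiv coeff_integ_Suc mult.assoc [symmetric] del: of_nat_Suc)
qed

text \<open>The integral over the unit interval.\<close>

definition integ01 :: "'k::field_char_0 poly3 poly \<Rightarrow> 'k poly3" where
  "integ01 p = poly (integ p) 1"

lemma integ01_add: "integ01 (p + q) = integ01 p + integ01 q"
  by (simp add: integ01_def integ_add)

lemma integ01_smult: "integ01 (smult c p) = c * integ01 p"
  by (simp add: integ01_def integ_smult)

lemma integ01_pderiv: "integ01 (pderiv p) = poly p 1 - poly p 0"
proof -
  have "pderiv (p - integ (pderiv p)) = 0" by (simp add: pderiv_diff pderiv_integ)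
  then obtain c where "p - integ (pderiv p) = [:c:]"
    by (metis pderiv_eq_0_iff degree_eq_zeroE)
  then have "p = [:c:] + integ (pderiv p)" by (simp add: algebra_simps)
  then have "poly p x = c + poly (integ (pderiv p)) x" for x
    by (metis poly_add poly_pCons poly_0 mult_zero_right add_0_right)
  then show ?thesis by (simp add: integ01_def)
qed

text \<open>
  The integral from \<open>v\<close> to \<open>u\<close> after the affine change of variables that maps the unit interval to
  the interval of integration: a zero of the integrand at an endpoint contributes a power of
  \<open>u - v\<close>.
\<close>

lemma integ_endpoint_zeros:
  assumes "p = [:- u, 1:] ^ a * [:- v, 1:] ^ b * r"
  shows "poly (integ p) u - poly (integ p) v
    = (u - v) ^ (a + b + 1) * integ01 ([:- 1, 1:] ^ a * [:0, 1:] ^ b * (r \<circ>\<^sub>p [:v, u - v:]))"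
proof -
  let ?q = "[:v, u - v:]"
  have pc: "(x ^ n) \<circ>\<^sub>p ?q = (x \<circ>\<^sub>p ?q) ^ n" for x n
    by (induction n) (simp_all add: pcompose_mult pcompose_1)
  have lin: "[:- u, 1:] \<circ>\<^sub>p ?q = smult (u - v) [:- 1, 1:]" "[:- v, 1:] \<circ>\<^sub>p ?q = smult (u - v) [:0, 1:]"
    by (simp_all add: pcompose_pCons)
  have "p \<circ>\<^sub>p ?q = smult ((u - v) ^ (a + b)) ([:- 1, 1:] ^ a * [:0, 1:] ^ b * (r \<circ>\<^sub>p ?q))"
    unfolding assms pcompose_mult pc lin smult_power by (simp add: power_add mult_ac)
  moreover have "pderiv (integ p \<circ>\<^sub>p ?q) = smult (u - v) (p \<circ>\<^sub>p ?q)"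
    by (simp add: pderiv_pcompose pderiv_integ pderiv_pCons)
  moreover have "poly (integ p \<circ>\<^sub>p ?q) 1 = poly (integ p) u"
    "poly (integ p \<circ>\<^sub>p ?q) 0 = poly (integ p) v"
    by (simp_all add: poly_pcompose)
  ultimately have "poly (integ p) u - poly (integ p) v
      = integ01 (smult (u - v) (smult ((u - v) ^ (a + b)) ([:- 1, 1:] ^ a * [:0, 1:] ^ b * (r \<circ>\<^sub>p ?q))))"
    using integ01_pderiv[of "integ p \<circ>\<^sub>p ?q"] by simp
  then show ?thesis by (simp add: integ01_smult mult_ac)
qed

text \<open>The beta integral, up to sign: only that it is a nonzero scalar matters.\<close>

lemma integ01_beta:
  "\<exists>c. c \<noteq> 0 \<and> integ01 ([:- 1, 1:] ^ a * [:0, 1:] ^ b) = Const (c :: 'k::field_char_0)"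
proof (induction a arbitrary: b)
  case 0
  have "[:0, 1:] ^ b = monom (1 :: 'k poly3) b" by (simp add: monom_altdef)
  moreover have "integ (monom 1 b) = monom (Const (inverse (of_nat (Suc b) :: 'k))) (Suc b)"
  proof (rule poly_eqI)
    show "coeff (integ (monom 1 b)) n
        = coeff (monom (Const (inverse (of_nat (Suc b) :: 'k))) (Suc b)) n" for n
      by (cases n) (simp_all add: coeff_integ_Suc)
  qed
  ultimately have "integ01 ([:0, 1:] ^ b) = Const (inverse (of_nat (Suc b) :: 'k))"
    by (simp add: integ01_def poly_monom)
  then show ?case
    by (intro exI[of _ "inverse (of_nat (Suc b))"]) (simp del: of_nat_Suc)
next
  case (Suc a)
  let ?B = "\<lambda>a b. integ01 ([:- 1, 1:] ^ a * [:0, 1:] ^ b) :: 'k poly3"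
  obtain c where c: "c \<noteq> 0" "?B a (Suc b) = Const c" using Suc[of "Suc b"] by blast
  have pd: "pderiv [:x, 1:] = 1" for x :: "'k poly3"
    by (simp add: pderiv_pCons one_pCons)
  \<comment> \<open>Integration by parts; the boundary terms vanish.\<close>
  have d: "pderiv ([:- 1, 1:] ^ Suc a * [:0, 1:] ^ Suc b)
      = smult (of_nat (Suc a)) ([:- 1, 1:] ^ a * [:0, 1:] ^ Suc b)
        + smult (of_nat (Suc b)) ([:- 1, 1:] ^ Suc a * [:0, 1 :: 'k poly3:] ^ b)"
    by (simp only: pderiv_mult pderiv_power_Suc pd mult_1_right mult_smult_left mult_smult_right
      add.commute mult.commute mult_1_left)
  have "of_nat (Suc a) * ?B a (Suc b) + of_nat (Suc b) * ?B (Suc a) b = 0"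
    using integ01_pderiv[of "[:- 1, 1:] ^ Suc a * [:0, 1 :: 'k poly3:] ^ Suc b"]
    unfolding d integ01_add integ01_smult by (simp add: poly_power)
  then have eq: "Const (of_nat (Suc b)) * ?B (Suc a) b = Const (- (of_nat (Suc a) * c))"
    unfolding c(2) Const_minus Const_mult Const_of_nat by (simp add: eq_neg_iff_add_eq_0 add.commute)
  have cancel: "x = u * (t * x)" if "t * u = 1" for x t u :: "'k poly3"
    using that mult.assoc[of t u x] by (simp add: mult.left_commute)
  have inv: "Const (of_nat (Suc b)) * Const (inverse (of_nat (Suc b))) = (1 :: 'k poly3)"
    by (rule Const_inverse_cancel) (simp del: of_nat_Suc)
  have "?B (Suc a) b
      = Const (inverse (of_nat (Suc b))) * (Const (of_nat (Suc b)) * ?B (Suc a) b)"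
    by (rule cancel[OF inv])
  then have "?B (Suc a) b = Const (- (of_nat (Suc a) * c) * inverse (of_nat (Suc b)))"
    unfolding eq Const_mult by (simp only: mult.commute)
  moreover have "- (of_nat (Suc a) * c) * inverse (of_nat (Suc b)) \<noteq> 0"
    using c(1) by (simp del: of_nat_Suc)
  ultimately show ?case by blast
qed

text \<open>
  The term of lowest order in \<open>u\<close> of an integral from \<open>0\<close> to \<open>u\<close>: up to a nonzero scalar its
  coefficient is the value at \<open>0\<close> of the factor \<open>r\<close> of the integrand.
\<close>

lemma integ_leading_term:
  fixes u :: "'k::field_char_0 poly3"
  obtains c s where "c \<noteq> 0"
    "poly (integ ([:- u, 1:] ^ a * [:0, 1:] ^ b * r)) u = u ^ (a + b + 1) * (Const c * poly r 0 + u * s)"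
proof -
  obtain c where c: "c \<noteq> 0" "integ01 ([:- 1, 1:] ^ a * [:0, 1:] ^ b) = Const (c :: 'k)"
    using integ01_beta by blast
  obtain r0 r' where r: "r = pCons r0 r'" by (cases r)
  let ?B = "[:- 1, 1:] ^ a * [:0, 1:] ^ b :: 'k poly3 poly"
  have "?B * (r \<circ>\<^sub>p [:0, u:]) = smult r0 ?B + smult u (?B * pCons 0 (r' \<circ>\<^sub>p [:0, u:]))"
    by (simp add: r pcompose_pCons distrib_left)
  then have "integ01 (?B * (r \<circ>\<^sub>p [:0, u:]))
      = Const c * poly r 0 + u * integ01 (?B * pCons 0 (r' \<circ>\<^sub>p [:0, u:]))"
    by (simp only: integ01_add integ01_smult c(2)) (simp add: r mult.commute)
  moreover have "poly (integ ([:- u, 1:] ^ a * [:0, 1:] ^ b * r)) u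
      = u ^ (a + b + 1) * integ01 (?B * (r \<circ>\<^sub>p [:0, u:]))"
    using integ_endpoint_zeros[of _ u a 0 b r, OF refl] by simp
  ultimately show thesis by (intro that[OF c(1)]) (simp only:)
qed

text \<open>Homogeneity of degree \<open>d\<close> when the new variable has degree one.\<close>

definition homogeneous_uni :: "nat \<Rightarrow> 'k::comm_ring_1 poly3 poly \<Rightarrow> bool" where
  "homogeneous_uni d p \<longleftrightarrow>
     (\<forall>n. if n \<le> d then homogeneous_poly (d - n) (coeff p n) else coeff p n = 0)"

lemma homogeneous_uni_linear:
  assumes "homogeneous_poly 1 u" shows "homogeneous_uni 1 [:u, 1:]"
proof -
  have "homogeneous_poly (1 - n) (coeff [:u, 1:] n)" if "n \<le> 1" for n
    using that assms homogeneous_poly_Const[of 1] by (cases n) auto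
  moreover have "coeff [:u, 1:] n = 0" if "\<not> n \<le> 1" for n
    using that by (auto simp: coeff_pCons split: nat.splits)
  ultimately show ?thesis by (simp add: homogeneous_uni_def)
qed

lemma homogeneous_uni_mult:
  assumes "homogeneous_uni d p" "homogeneous_uni d' q" shows "homogeneous_uni (d + d') (p * q)"
proof -
  have 1: "homogeneous_poly (d + d' - n) (coeff p i * coeff q (n - i))" if "n \<le> d + d'" "i \<le> n" for n i
  proof (cases "i \<le> d \<and> n - i \<le> d'")
    case True
    then have "homogeneous_poly (d - i + (d' - (n - i))) (coeff p i * coeff q (n - i))"
      using assms by (intro homogeneous_poly_mult) (simp_all add: homogeneous_uni_def)
    moreover have "d - i + (d' - (n - i)) = d + d' - n" using True that by linarith
    ultimately show ?thesis by simp
  next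
    case False
    then show ?thesis using assms by (auto simp: homogeneous_uni_def)
  qed
  have 2: "coeff p i * coeff q (n - i) = 0" if "\<not> n \<le> d + d'" "i \<le> n" for n i
  proof -
    have "\<not> i \<le> d \<or> \<not> n - i \<le> d'" using that by linarith
    then show ?thesis using assms by (metis homogeneous_uni_def mult_zero_left mult_zero_right)
  qed
  show ?thesis
    unfolding homogeneous_uni_def coeff_mult
    using 1 2 by (auto intro!: homogeneous_poly_sum sum.neutral)
qed

lemma homogeneous_uni_power:
  assumes "homogeneous_uni d p" shows "homogeneous_uni (n * d) (p ^ n)"
proof (induction n)
  case 0
  show ?case using homogeneous_poly_Const[of 1] by (simp add: homogeneous_uni_def)
next
  case (Suc n)
  then show ?case using homogeneous_uni_mult[OF assms] by simp
qed

lemma homogeneous_poly_integ: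
  assumes "homogeneous_uni d p" "homogeneous_poly 1 u"
  shows "homogeneous_poly (Suc d) (poly (integ p) u)"
  unfolding poly_altdef
proof (rule homogeneous_poly_sum)
  fix n
  show "homogeneous_poly (Suc d) (coeff (integ p) n * u ^ n)"
  proof (cases n)
    case (Suc i)
    show ?thesis
    proof (cases "i \<le> d")
      case True
      then have "homogeneous_poly (d - i + 1 * n) (coeff (integ p) n * u ^ n)"
        using assms unfolding Suc coeff_integ_Suc
        by (intro homogeneous_poly_mult homogeneous_poly_Const_mult homogeneous_poly_power)
          (simp_all add: homogeneous_uni_def)
      then show ?thesis using True Suc by simp
    next
      case False
      then show ?thesis using assms(1) by (simp add: Suc coeff_integ_Suc homogeneous_uni_def)
    qed
  qed simp
qed

section \<open>Saito's criterion for the braid arrangement in adapted coordinates\<close>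

subsection \<open>Matrices of size three over a commutative ring\<close>

lemma dvd_det_if_dvd_row:
  fixes A :: "'a::comm_ring_1 ^ 3 ^ 3"
  assumes "\<And>k. p dvd A $ i $ k" shows "p dvd det A"
  using exhaust_3[of i] assms by (auto simp: det_3 intro!: dvd_add dvd_diff)

lemma dvd_det_if_dvd_row_diff:
  fixes A :: "'a::comm_ring_1 ^ 3 ^ 3"
  assumes "i \<noteq> j" "\<And>k. p dvd A $ i $ k - A $ j $ k" shows "p dvd det A"
proof -
  have "p dvd det (\<chi> k. if k = i then row i A + (- 1) *s row j A else row k A)"
    by (rule dvd_det_if_dvd_row[of _ _ i]) (use assms(2) in \<open>simp add: row_def\<close>)
  then show ?thesis unfolding det_row_operation[OF assms(1)] .
qed

lemma matrix_vector_mult_cramer_det: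
  fixes A :: "'a::comm_ring_1 ^ 3 ^ 3"
  shows "A *v (\<chi> k. det (\<chi> i j. if j = k then y $ i else A $ i $ j)) = det A *s y"
  by (simp add: vec_eq_iff forall_3 matrix_vector_mult_def sum_3 det_3 algebra_simps)

lemma cramer_det_matrix_vector_mult:
  fixes A :: "'a::comm_ring_1 ^ 3 ^ 3"
  shows "det (\<chi> i j. if j = k then (A *v x) $ i else A $ i $ j) = det A * x $ k"
  using exhaust_3[of k]
  by (elim disjE) (simp_all add: matrix_vector_mult_def sum_3 det_3 algebra_simps)

lemma homogeneous_poly_det:
  fixes A :: "'k::comm_ring_1 poly3 ^ 3 ^ 3"
  assumes "\<And>i k. homogeneous_poly n (A $ i $ k)" shows "homogeneous_poly (3 * n) (det A)"
proof -
  have prod: "homogeneous_poly (3 * n) (A $ i $ j * A $ i' $ j' * A $ i'' $ j'')" for i j i' j' i'' j''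
    using homogeneous_poly_mult[OF homogeneous_poly_mult[OF assms assms] assms, of i j i' j' i'' j'']
    by (simp add: numeral_3_eq_3 add.assoc)
  show ?thesis
    unfolding det_3 by (intro homogeneous_poly_add homogeneous_poly_diff prod)
qed

text \<open>
  Powers of prime elements, none of which divides a later one, are treated as a list of pairs of
  a base and an exponent.
\<close>

lemma prod_list_prime_powers_dvd:
  fixes ps :: "('a::idom \<times> nat) list"
  assumes "sorted_wrt (\<lambda>x y. \<not> fst x dvd fst y) ps"
    and "\<And>x. x \<in> set ps \<Longrightarrow> prime_elem (fst x) \<and> fst x ^ snd x dvd f"
  shows "prod_list (map (\<lambda>x. fst x ^ snd x) ps) dvd f"
  using assms
proof (induction ps)
  case (Cons x ps)
  have p: "prime_elem (fst x)" using Cons.prems(2) by simp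
  have "\<not> fst x dvd prod_list (map (\<lambda>x. fst x ^ snd x) qs)" if "\<forall>y\<in>set qs. \<not> fst x dvd fst y" for qs
    using that
  proof (induction qs)
    case Nil
    then show ?case using p by (simp add: prime_elem_def)
  next
    case (Cons y qs)
    then have "\<not> fst x dvd fst y ^ snd y" using prime_elem_dvd_power[OF p] by auto
    then show ?case using Cons p unfolding prime_elem_def by auto
  qed
  then have "\<not> fst x dvd prod_list (map (\<lambda>x. fst x ^ snd x) ps)" using Cons.prems(1) by simp
  then have "prod_list (map (\<lambda>x. fst x ^ snd x) ps) * fst x ^ snd x dvd f"
    using Cons.prems by (intro prime_elem_power_mult_dvd[OF p] Cons.IH) auto
  then show ?case by (simp add: mult.commute)
qed simp

subsection \<open>Adapted coordinates\<close>

text \<open>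
  The rows of \<open>B\<close> are the coefficient vectors of three independent linear forms \<open>L i\<close>, and the
  columns of \<open>V\<close> are the dual basis.  In the coordinates \<open>L\<close> the braid arrangement consists of
  the planes \<open>L i = 0\<close> and \<open>L i = L j\<close>.
\<close>

locale adapted_coordinates =
  fixes B V :: "'k::field_char_0 ^ 3 ^ 3"
  assumes BV: "B ** V = mat 1"
begin

lemma VB: "V ** B = mat 1"
  using BV matrix_left_right_inverse by blast

definition L :: "3 \<Rightarrow> 'k poly3" where
  "L i = linform_poly (B $ i)"

text \<open>The partial derivative with respect to the \<open>k\<close>-th new coordinate.\<close>

definition D :: "3 \<Rightarrow> 'k poly3 \<Rightarrow> 'k poly3" where
  "D k = der_apply (\<chi> j. Const (V $ j $ k))"

text \<open>The components of a derivation in the new coordinates are its values on them.\<close>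

definition coords :: "'k der \<Rightarrow> 'k poly3 ^ 3" where
  "coords \<eta> = (\<chi> i. der_apply \<eta> (L i))"

text \<open>The Jacobian matrix in the new coordinates; the rows belong to the functions.\<close>

definition jacobian :: "'k poly3 ^ 3 \<Rightarrow> 'k poly3 ^ 3 ^ 3" where
  "jacobian f = (\<chi> i k. D k (f $ i))"

text \<open>One ordered pair of indices for each plane \<open>L i = L j\<close>.\<close>

definition pairs :: "(3 \<times> 3) set" where
  "pairs = {(1, 2), (2, 3), (1, 3)}"

text \<open>
  The components, in the coordinates \<open>L\<close>, of the logarithmic derivations for the multiplicity
  \<open>a i\<close> on the plane \<open>L i = 0\<close> and \<open>b i j\<close> on the plane \<open>L i = L j\<close>.
\<close>

definition mlog :: "(3 \<Rightarrow> nat) \<Rightarrow> (3 \<Rightarrow> 3 \<Rightarrow> nat) \<Rightarrow> ('k poly3 ^ 3) set" where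
  "mlog a b = {\<psi>. (\<forall>i. L i ^ a i dvd \<psi> $ i) \<and> (\<forall>(i, j)\<in>pairs. (L i - L j) ^ b i j dvd \<psi> $ i - \<psi> $ j)}"

lemma mlogD_diff:
  "\<psi> \<in> mlog a b \<Longrightarrow> (i, j) \<in> pairs \<Longrightarrow> (L i - L j) ^ b i j dvd \<psi> $ i - \<psi> $ j"
  by (auto simp: mlog_def)

text \<open>The defining polynomial of the multiarrangement.\<close>

definition Q :: "(3 \<Rightarrow> nat) \<Rightarrow> (3 \<Rightarrow> 3 \<Rightarrow> nat) \<Rightarrow> 'k poly3" where
  "Q a b = L 1 ^ a 1 * L 2 ^ a 2 * L 3 ^ a 3
     * (L 1 - L 2) ^ b 1 2 * (L 2 - L 3) ^ b 2 3 * (L 1 - L 3) ^ b 1 3"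

lemma sum_BV: "(\<Sum>j\<in>UNIV. B $ i $ j * V $ j $ k) = (if i = k then 1 else 0)"
  using arg_cong[OF BV, of "\<lambda>A. A $ i $ k"] by (simp add: matrix_matrix_mult_def mat_def)

lemma sum_VB: "(\<Sum>j\<in>UNIV. V $ i $ j * B $ j $ k) = (if i = k then 1 else 0)"
  using arg_cong[OF VB, of "\<lambda>A. A $ i $ k"] by (simp add: matrix_matrix_mult_def mat_def)

lemma Const_sum_mult: "(\<Sum>j\<in>UNIV. Const (u j) * Const (w j)) = Const (\<Sum>j\<in>UNIV. u j * w j)"
  by (simp add: Const_sum Const_mult)

lemma coords_nth: "coords \<eta> $ i = (\<Sum>j\<in>UNIV. Const (B $ i $ j) * \<eta> $ j)"
  by (simp add: coords_def L_def der_apply_linform)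

lemma inverse_coords: "(\<Sum>k\<in>UNIV. Const (V $ j $ k) * coords \<eta> $ k) = \<eta> $ j"
proof -
  have "(\<Sum>k\<in>UNIV. Const (V $ j $ k) * coords \<eta> $ k)
      = (\<Sum>k\<in>UNIV. \<Sum>i\<in>UNIV. Const (V $ j $ k) * (Const (B $ k $ i) * \<eta> $ i))"
    by (simp add: coords_nth sum_distrib_left)
  also have "\<dots> = (\<Sum>i\<in>UNIV. (\<Sum>k\<in>UNIV. Const (V $ j $ k) * Const (B $ k $ i)) * \<eta> $ i)"
    by (subst sum.swap) (simp add: sum_distrib_right mult.assoc)
  also have "\<dots> = (\<Sum>i\<in>UNIV. if i = j then \<eta> $ i else 0)"
    by (rule sum.cong) (auto simp: Const_sum_mult sum_VB)
  finally show ?thesis by simp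
qed

lemma coords_inverse: "coords (\<chi> j. \<Sum>k\<in>UNIV. Const (V $ j $ k) * \<psi> $ k) = \<psi>"
proof -
  have "coords (\<chi> j. \<Sum>k\<in>UNIV. Const (V $ j $ k) * \<psi> $ k) $ i = \<psi> $ i" for i
  proof -
    have "coords (\<chi> j. \<Sum>k\<in>UNIV. Const (V $ j $ k) * \<psi> $ k) $ i
        = (\<Sum>j\<in>UNIV. \<Sum>k\<in>UNIV. Const (B $ i $ j) * (Const (V $ j $ k) * \<psi> $ k))"
      by (simp add: coords_nth sum_distrib_left)
    also have "\<dots> = (\<Sum>k\<in>UNIV. (\<Sum>j\<in>UNIV. Const (B $ i $ j) * Const (V $ j $ k)) * \<psi> $ k)"
      by (subst sum.swap) (simp add: sum_distrib_right mult.assoc)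
    also have "\<dots> = (\<Sum>k\<in>UNIV. if k = i then \<psi> $ k else 0)"
      by (rule sum.cong) (auto simp: Const_sum_mult sum_BV)
    finally show ?thesis by simp
  qed
  then show ?thesis by (simp add: vec_eq_iff)
qed

lemma bij_coords: "bij coords"
proof (rule bijI)
  show "inj coords"
  proof (rule injI)
    fix \<phi> \<eta> assume "coords \<phi> = coords \<eta>"
    then have "\<phi> $ j = \<eta> $ j" for j
      using inverse_coords[of j \<phi>] inverse_coords[of j \<eta>] by simp
    then show "\<phi> = \<eta>" by (simp add: vec_eq_iff)
  qed
  show "surj coords"
    by (rule surjI) (rule coords_inverse)
qed

lemma der_apply_eq_coords: "der_apply \<phi> f = (\<Sum>k\<in>UNIV. coords \<phi> $ k * D k f)"
proof -
  have "(\<Sum>k\<in>UNIV. coords \<phi> $ k * D k f)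
      = (\<Sum>k\<in>UNIV. \<Sum>j\<in>UNIV. Const (V $ j $ k) * coords \<phi> $ k * partial_deriv j f)"
    by (simp add: D_def der_apply_def sum_distrib_left mult_ac)
  also have "\<dots> = (\<Sum>j\<in>UNIV. (\<Sum>k\<in>UNIV. Const (V $ j $ k) * coords \<phi> $ k) * partial_deriv j f)"
    by (subst sum.swap) (simp add: sum_distrib_right)
  finally show ?thesis by (simp add: inverse_coords der_apply_def)
qed

lemma coords_nabla: "coords (nabla \<phi> \<theta>) = jacobian (coords \<theta>) *v coords \<phi>"
proof -
  have "coords (nabla \<phi> \<theta>) $ i = der_apply \<phi> (coords \<theta> $ i)" for i
    by (simp add: coords_nth nabla_def der_apply_sum der_apply_mult)
  then show ?thesis
    by (simp add: vec_eq_iff jacobian_def matrix_vector_mult_def der_apply_eq_coords mult.commute)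
qed

lemma D_L: "D k (L i) = (if i = k then 1 else 0)"
  by (simp add: D_def L_def der_apply_linform Const_sum_mult sum_BV)

lemma homogeneous_poly_L: "homogeneous_poly 1 (L i)"
  by (simp only: L_def homogeneous_poly_linform)

lemma homogeneous_poly_D: "homogeneous_poly n f \<Longrightarrow> homogeneous_poly (n - 1) (D k f)"
  unfolding D_def der_apply_def vec_lambda_beta
  by (intro homogeneous_poly_sum homogeneous_poly_Const_mult homogeneous_poly_partial_deriv)

subsection \<open>The six linear forms\<close>

lemma L_diff: "L i - L j = linform_poly (B $ i - B $ j)"
  by (simp add: L_def linform_poly_diff)

text \<open>
  Two linear forms are not proportional if some minor of the matrix of their coordinates with
  respect to \<open>L 1\<close>, \<open>L 2\<close>, \<open>L 3\<close> is not zero.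
\<close>

lemma linform_not_dvd:
  assumes "\<exists>i j. (\<Sum>l\<in>UNIV. p $ l * V $ l $ i) * (\<Sum>l\<in>UNIV. q $ l * V $ l $ j)
    \<noteq> (\<Sum>l\<in>UNIV. p $ l * V $ l $ j) * (\<Sum>l\<in>UNIV. q $ l * V $ l $ i)"
  shows "\<not> linform_poly p dvd linform_poly q"
proof
  assume dvd: "linform_poly p dvd linform_poly q"
  have "p \<noteq> 0" using assms by auto
  then obtain c where "q = c *s p" using dvd linform_dvd_linformD by blast
  then have "(\<Sum>l\<in>UNIV. q $ l * V $ l $ i) = c * (\<Sum>l\<in>UNIV. p $ l * V $ l $ i)" for i
    by (simp add: sum_distrib_left mult.assoc)
  then show False using assms by (simp add: mult_ac)
qed

lemma sum_diff_BV:
  "(\<Sum>l\<in>UNIV. (B $ i - B $ j) $ l * V $ l $ k) = (if i = k then 1 else 0) - (if j = k then 1 else 0)"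
  by (simp add: left_diff_distrib sum_subtractf sum_BV)

lemma B_nonzero: "B $ i \<noteq> 0"
proof
  assume "B $ i = 0"
  then show False using sum_BV[of i i] by simp
qed

lemma B_diff_nonzero: "i \<noteq> j \<Longrightarrow> B $ i - B $ j \<noteq> 0"
proof
  assume "B $ i - B $ j = 0" "i \<noteq> j"
  then show False using sum_diff_BV[of i j i] by simp
qed

lemma prime_L: "prime_elem (L i)"
  unfolding L_def by (rule prime_elem_linform[OF B_nonzero])

lemma prime_L_diff: "i \<noteq> j \<Longrightarrow> prime_elem (L i - L j)"
  unfolding L_diff by (rule prime_elem_linform[OF B_diff_nonzero])

lemma L_nonzero: "L i \<noteq> 0"
  by (simp add: L_def B_nonzero)

lemma L_diff_nonzero: "i \<noteq> j \<Longrightarrow> L i - L j \<noteq> 0"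
  using B_diff_nonzero[of i j] by (simp only: L_diff linform_poly_eq_0_iff) simp

lemma L_not_dvd_L:
  assumes "i \<noteq> j" shows "\<not> L i dvd L j"
  unfolding L_def using assms by (intro linform_not_dvd exI[of _ i] exI[of _ j]) (simp add: sum_BV)

lemma not_all_3: "\<not> (P 1 1 \<and> P 1 2 \<and> P 1 3 \<and> P 2 1 \<and> P 2 2 \<and> P 2 3 \<and> P 3 1 \<and> P 3 2 \<and> P 3 3)
    \<Longrightarrow> \<exists>i j::3. \<not> P i j"
  by blast

lemma six_forms_not_dvd:
  "sorted_wrt (\<lambda>x y. \<not> fst x dvd fst y)
     [(L 1, n1), (L 2, n2), (L 3, n3), (L 1 - L 2, n4), (L 2 - L 3, n5), (L 1 - L 3, n6)]"
  unfolding L_diff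
  by (simp add: L_def; intro conjI; rule linform_not_dvd; rule not_all_3;
      simp add: sum_BV sum_diff_BV del: vector_minus_component)

lemma Q_dvd_det:
  assumes "\<And>k. (\<chi> i. A $ i $ k) \<in> mlog a b" shows "Q a b dvd det A"
proof -
  have 1: "L i ^ a i dvd det A" for i
    using assms by (intro dvd_det_if_dvd_row[of _ _ i]) (simp add: mlog_def)
  have 2: "(L i - L j) ^ b i j dvd det A" if "(i, j) \<in> pairs" for i j
  proof (rule dvd_det_if_dvd_row_diff)
    show "i \<noteq> j" using that by (auto simp: pairs_def)
    show "(L i - L j) ^ b i j dvd A $ i $ k - A $ j $ k" for k
      using mlogD_diff[OF assms that, of k] by simp
  qed
  have "prod_list (map (\<lambda>x. fst x ^ snd x) [(L 1, a 1), (L 2, a 2), (L 3, a 3),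
      (L 1 - L 2, b 1 2), (L 2 - L 3, b 2 3), (L 1 - L 3, b 1 3)]) dvd det A"
    by (rule prod_list_prime_powers_dvd[OF six_forms_not_dvd]) (use 1 2 in \<open>auto simp: prime_L prime_L_diff pairs_def\<close>)
  then show ?thesis by (simp add: Q_def mult.assoc)
qed

lemma Q_nonzero: "Q a b \<noteq> 0"
  using L_diff_nonzero[of 1 2] L_diff_nonzero[of 2 3] L_diff_nonzero[of 1 3]
  by (auto simp: Q_def L_nonzero)

lemma homogeneous_poly_L_diff: "homogeneous_poly 1 (L i - L j)"
  by (intro homogeneous_poly_diff homogeneous_poly_L)

lemma homogeneous_poly_Q: "homogeneous_poly (a 1 + a 2 + a 3 + b 1 2 + b 2 3 + b 1 3) (Q a b)"
proof -
  have 1: "homogeneous_poly n (L i ^ n)" for i n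
    using homogeneous_poly_power[OF homogeneous_poly_L, of n i] by simp
  have 2: "homogeneous_poly n ((L i - L j) ^ n)" for i j n
    using homogeneous_poly_power[OF homogeneous_poly_L_diff, of n i j] by simp
  show ?thesis unfolding Q_def by (intro homogeneous_poly_mult 1 2)
qed

lemma matrix_vector_mult_in_mlog:
  assumes "\<And>k. (\<chi> i. A $ i $ k) \<in> mlog a b" shows "A *v x \<in> mlog a b"
proof -
  have "(L i - L j) ^ b i j dvd (A *v x) $ i - (A *v x) $ j" if "(i, j) \<in> pairs" for i j
  proof -
    have "(A *v x) $ i - (A *v x) $ j = (\<Sum>k\<in>UNIV. (A $ i $ k - A $ j $ k) * x $ k)"
      by (simp add: matrix_vector_mult_def left_diff_distrib sum_subtractf)
    also have "(L i - L j) ^ b i j dvd \<dots>"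
      using mlogD_diff[OF assms that] by (intro dvd_sum dvd_mult2) simp
    finally show ?thesis .
  qed
  moreover have "L i ^ a i dvd (A *v x) $ i" for i
    using assms by (auto simp: matrix_vector_mult_def mlog_def intro!: dvd_sum dvd_mult2)
  ultimately show ?thesis by (auto simp: mlog_def)
qed

text \<open>
  Saito's criterion: three elements of the module form a basis of it when the determinant of
  their matrix is a nonzero scalar multiple of the defining polynomial.
\<close>

lemma saito_criterion:
  assumes cols: "\<And>k. (\<chi> i. A $ i $ k) \<in> mlog a b"
    and det: "det A = Q a b * Const c" and "c \<noteq> 0"
  shows "bij_betw ((*v) A) UNIV (mlog a b)"
proof -
  have det0: "det A \<noteq> 0" using det Q_nonzero \<open>c \<noteq> 0\<close> by simp
  have "inj ((*v) A)"
  proof (rule injI)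
    fix x y assume eq: "A *v x = A *v y"
    have "det A * x $ k = det A * y $ k" for k
      using cramer_det_matrix_vector_mult[where A = A and k = k and x = x, unfolded eq]
        cramer_det_matrix_vector_mult[where A = A and k = k and x = y] by auto
    then show "x = y" using det0 by (simp add: vec_eq_iff)
  qed
  moreover have "y \<in> range ((*v) A)" if y: "y \<in> mlog a b" for y
  proof -
    let ?N = "\<lambda>k. det (\<chi> i j. if j = k then y $ i else A $ i $ j)"
    have "Q a b dvd ?N k" for k
    proof (rule Q_dvd_det)
      show "(\<chi> i. (\<chi> i j. if j = k then y $ i else A $ i $ j) $ i $ l) \<in> mlog a b" for l
        using y cols[of l] by (cases "l = k") simp_all
    qed
    then have "\<exists>q. ?N k = Q a b * q" for k by (auto elim: dvdE)
    then obtain q where q: "\<And>k. ?N k = Q a b * q k" by metis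
    define x where "x = (\<chi> k. Const (inverse c) * q k)"
    have "?N k = det A * x $ k" for k
      using Const_inverse_cancel[OF \<open>c \<noteq> 0\<close>] by (simp add: q det x_def mult.assoc)
    then have "(\<chi> k. ?N k) = det A *s x" by (simp add: vec_eq_iff)
    then have "det A *s y = A *v (det A *s x)"
      using matrix_vector_mult_cramer_det[of A y] by simp
    also have "\<dots> = det A *s (A *v x)"
      by (simp add: vec_eq_iff matrix_vector_mult_def sum_distrib_left mult_ac)
    finally have "y = A *v x" using det0 by (simp add: vec_eq_iff)
    then show ?thesis by blast
  qed
  ultimately show ?thesis
    using matrix_vector_mult_in_mlog[OF cols] by (auto simp: bij_betw_def)
qed

text \<open>
  Conversely, let the columns of \<open>A\<close> generate the module.  The determinant is not zero because
  the module contains the multiples of the defining polynomial, so that \<open>A\<close> has a right inverse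
  up to this factor.
\<close>

lemma det_of_generators:
  assumes "range ((*v) A) = mlog a b" shows "det A \<noteq> 0" "Q a b dvd det A"
proof -
  have dvd: "L i ^ a i dvd Q a b" for i
    using exhaust_3[of i] by (auto simp: Q_def)
  have "(L i - L j) ^ b i j dvd Q a b" if "(i, j) \<in> pairs" for i j
    using that by (auto simp: Q_def pairs_def)
  then have "(\<chi> i. if i = k then Q a b else 0) \<in> mlog a b" for k
    using dvd by (auto simp: mlog_def)
  then have "(\<chi> i. if i = k then Q a b else 0) \<in> range ((*v) A)" for k
    unfolding assms .
  then have "\<exists>x. A *v x = (\<chi> i. if i = k then Q a b else 0)" for k
    unfolding image_iff by (simp only: eq_commute[of "_ *v _"] bex_UNIV)
  then obtain x where x: "\<And>k. A *v x k = (\<chi> i. if i = k then Q a b else 0)" by metis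
  have "A ** (\<chi> i k. x k $ i) = mat (Q a b)"
    using x by (simp add: vec_eq_iff matrix_matrix_mult_def matrix_vector_mult_def mat_def)
  then have "det A * det (\<chi> i k. x k $ i) = det (mat (Q a b) :: 'k poly3 ^ 3 ^ 3)"
    by (simp flip: det_mul)
  also have "\<dots> = Q a b ^ 3" by (simp add: det_3 mat_def power3_eq_cube)
  finally show "det A \<noteq> 0" using Q_nonzero by auto
  have "A *v axis k 1 = (\<chi> i. A $ i $ k)" for k
    by (simp add: vec_eq_iff matrix_vector_mult_def axis_def if_distrib cong: if_cong)
  then have "(\<chi> i. A $ i $ k) \<in> mlog a b" for k
    unfolding assms [symmetric] by (metis rangeI)
  then show "Q a b dvd det A" by (rule Q_dvd_det)
qed

end

section \<open>Equality is necessary\<close>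

context adapted_coordinates begin

text \<open>
  The number \<open>n - 1\<close> is the degree of the entries of the Jacobian matrix.  The truncated
  subtraction is harmless: for \<open>n = 0\<close> the entries are zero, hence homogeneous of degree \<open>0\<close>.
\<close>

lemma equalities_if_generators:
  fixes a :: "3 \<Rightarrow> nat" and b :: "3 \<Rightarrow> 3 \<Rightarrow> nat"
  assumes hom: "\<And>i. homogeneous_poly n (f $ i)"
    and range: "range ((*v) (jacobian f)) = mlog a b"
    and ge: "\<And>i j. (i, j) \<in> pairs \<Longrightarrow> a i + a j \<le> b i j"
    and "(i, j) \<in> pairs"
  shows "b i j = a i + a j"
proof -
  let ?d = "a 1 + a 2 + a 3"
  have jac: "homogeneous_poly (n - 1) (jacobian f $ i $ k)" for i k
    unfolding jacobian_def by (simp add: homogeneous_poly_D[OF hom, simplified])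
  \<comment> \<open>The determinant bounds \<open>n - 1\<close> from below.\<close>
  obtain q where q: "det (jacobian f) = Q a b * q"
    using det_of_generators(2)[OF range] by blast
  have "a 1 + a 2 + a 3 + b 1 2 + b 2 3 + b 1 3 \<le> 3 * (n - 1)"
  proof (rule homogeneous_combination_degree[where I = "{()}"])
    show "homogeneous_poly (3 * (n - 1)) (det (jacobian f))"
      by (rule homogeneous_poly_det[OF jac])
    show "det (jacobian f) \<noteq> 0" by (rule det_of_generators(1)[OF range])
    show "det (jacobian f) = (\<Sum>i\<in>{()}. q * Q a b)" by (simp add: q mult.commute)
  qed (rule homogeneous_poly_Q)
  \<comment> \<open>A derivation with equal values on the three coordinates bounds \<open>n - 1\<close> from above.\<close>
  moreover have "n - 1 \<le> ?d"
  proof -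
    let ?g = "L 1 ^ a 1 * L 2 ^ a 2 * L 3 ^ a 3"
    have "L i ^ a i dvd ?g" for i using exhaust_3[of i] by auto
    then have "(\<chi> i. ?g) \<in> mlog a b" by (auto simp: mlog_def)
    then have "(\<chi> i. ?g) \<in> range ((*v) (jacobian f))" unfolding range .
    then obtain x where "(\<chi> i. ?g) = jacobian f *v x" by blast
    then have "\<forall>i. ?g = (jacobian f *v x) $ i" by (simp add: vec_eq_iff)
    then have "?g = (jacobian f *v x) $ 1" by (rule spec)
    then have "?g = (\<Sum>k\<in>UNIV. x $ k * jacobian f $ 1 $ k)"
      by (simp add: matrix_vector_mult_def mult.commute)
    moreover have "homogeneous_poly n (L i ^ n)" for i n
      using homogeneous_poly_power[OF homogeneous_poly_L, of n i] by simp
    then have "homogeneous_poly ?d ?g" by (intro homogeneous_poly_mult)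
    moreover have "?g \<noteq> 0" by (simp add: L_nonzero)
    ultimately show ?thesis 
      using homogeneous_combination_degree[where I = UNIV and \<psi> = "\<lambda>k. x $ k"
          and p = "\<lambda>k. jacobian f $ 1 $ k", OF jac[of 1]] by blast
  qed
  moreover have "a 1 + a 2 \<le> b 1 2" "a 2 + a 3 \<le> b 2 3" "a 1 + a 3 \<le> b 1 3"
    using ge by (auto simp: pairs_def)
  ultimately have "b 1 2 = a 1 + a 2 \<and> b 2 3 = a 2 + a 3 \<and> b 1 3 = a 1 + a 3" by linarith
  then show ?thesis using \<open>(i, j) \<in> pairs\<close> by (auto simp: pairs_def)
qed

end

section \<open>Equality is sufficient\<close>

context adapted_coordinates begin

lemma D_add: "D k (f + g) = D k f + D k g"
  by (simp add: D_def der_apply_add)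

lemma D_mult: "D k (f * g) = D k f * g + f * D k g"
  by (simp add: D_def der_apply_mult)

lemma D_Const [simp]: "D k (Const c) = 0"
  by (simp add: D_def)

lemma D_L_power: "D k (L i ^ Suc n) = (if i = k then of_nat (Suc n) * L i ^ n else 0)"
  using D_L[of k i] der_apply_power_Suc[of _ "L i" n] by (simp only: D_def) simp

lemma D_L_same_power:
  "D k (L k ^ Suc n * f) = L k ^ n * (of_nat (Suc n) * f + L k * D k f)"
  unfolding D_mult D_L_power by (simp add: algebra_simps)

lemma D_L_other_power:
  "i \<noteq> k \<Longrightarrow> D k (L i ^ n * f) = L i ^ n * D k f"
  by (cases n) (simp_all add: D_mult D_L_power del: power_Suc)

text \<open>
  The first summand is not a multiple of \<open>L 3\<close>, because \<open>L 1 ^ n\<close> is not in the ideal generated by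
  \<open>L 2\<close> and \<open>L 3\<close>.
\<close>

lemma linear_combination_L2_L3_nonzero:
  assumes "c \<noteq> 0"
  shows "L 2 ^ l * (Const c * L 1 ^ n + L 2 * x) + L 3 * y \<noteq> 0"
proof
  assume "L 2 ^ l * (Const c * L 1 ^ n + L 2 * x) + L 3 * y = 0"
  then have "L 2 ^ l * (Const c * L 1 ^ n + L 2 * x) = L 3 * (- y)"
    by (simp add: eq_neg_iff_add_eq_0)
  then have "L 3 dvd L 2 ^ l * (Const c * L 1 ^ n + L 2 * x)" by simp
  moreover have "\<not> L 3 dvd L 2 ^ l"
    using prime_elem_dvd_power[OF prime_L] L_not_dvd_L[of 3 2] by auto
  ultimately have "L 3 dvd Const c * L 1 ^ n + L 2 * x"
    using prime_L[of 3] unfolding prime_elem_def by blast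
  \<comment> \<open>Restriction to the plane \<open>L 3 = 0\<close>.\<close>
  moreover define v where "v = (\<chi> j. V $ j $ 3)"
  have v: "(\<Sum>j\<in>UNIV. B $ i $ j * v $ j) = (if i = 3 then 1 else 0)" for i
    by (simp add: v_def sum_BV)
  ultimately have "plane_proj (B $ 3) v (Const c * L 1 ^ n + L 2 * x) = 0"
    unfolding L_def by (subst linform_dvd_iff_plane_proj[symmetric]) simp_all
  moreover have "plane_proj (B $ 3) v (L i) = L i" if "i \<noteq> 3" for i
    using that by (simp add: L_def plane_proj_linform v)
  ultimately have "Const c * L 1 ^ n + L 2 * plane_proj (B $ 3) v x = 0"
    by (simp add: plane_proj_simps)
  then have "Const c * L 1 ^ n = L 2 * (- plane_proj (B $ 3) v x)"
    by (simp add: eq_neg_iff_add_eq_0)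
  then have "L 2 dvd Const c * L 1 ^ n" by simp
  then have "L 2 dvd Const (inverse c) * (Const c * L 1 ^ n)" by (rule dvd_mult)
  then have "L 2 dvd L 1 ^ n" unfolding Const_inverse_cancel_left[OF assms] .
  then show False
    using prime_elem_dvd_power[OF prime_L] L_not_dvd_L[of 2 1] by auto
qed

text \<open>
  The Jacobian determinant of three polynomials is not zero when, for \<open>L 1\<close>, \<open>L 2\<close>, \<open>L 3\<close> of
  decreasing size, their leading terms are monomials with independent exponents.
\<close>

lemma det_jacobian_nonzero:
  assumes f1: "f $ 1 = Const c1 * L 1 ^ Suc n1 + L 2 * p1 + L 3 * q1"
    and f2: "f $ 2 = L 2 ^ Suc n2 * (Const c2 * L 1 ^ l + L 2 * p2) + L 3 * q2"
    and f3: "f $ 3 = L 3 ^ Suc n3 * (Const c3 * L 1 ^ r * L 2 ^ s + L 3 * q3)"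
    and c: "c1 \<noteq> 0" "c2 \<noteq> 0" "c3 \<noteq> 0"
  shows "det (jacobian f) \<noteq> 0"
proof -
  let ?A = "jacobian f"
  have J: "?A $ i $ k = D k (f $ i)" for i k by (simp add: jacobian_def)
  have D2: "D k (L 2 * x) = L 2 * D k x + (if k = 2 then x else 0)" for k x
    by (simp add: D_mult D_L)
  have D3: "D k (L 3 * x) = L 3 * D k x" if "k \<noteq> 3" for k x
    using that by (simp add: D_mult D_L)
  let ?C1 = "of_nat (Suc n1) * Const c1 * L 1 ^ n1"
  let ?C2 = "of_nat (Suc n2) * Const c2 * L 1 ^ l"
  let ?C3 = "of_nat (Suc n3) * Const c3 * L 1 ^ r * L 2 ^ s"
  have "D 1 (Const c1 * L 1 ^ Suc n1) = ?C1"
    by (simp only: D_mult[of _ "Const c1"] D_Const D_L_power) simp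
  then obtain u v where 11: "?A $ 1 $ 1 = ?C1 + L 2 * u + L 3 * v"
    using that[of "D 1 p1" "D 1 q1"] by (simp add: J f1 D_add D2 D3 del: power_Suc of_nat_Suc)
  have "?A $ 2 $ 1 = L 2 ^ Suc n2 * D 1 (Const c2 * L 1 ^ l + L 2 * p2) + L 3 * D 1 q2"
    unfolding J f2 D_add[of _ "L 2 ^ Suc n2 * _"]
    using D3[of 1 q2] D_L_other_power[of 2 1 "Suc n2"] by (simp del: power_Suc)
  then obtain u21 v21 where 21: "?A $ 2 $ 1 = L 2 ^ Suc n2 * u21 + L 3 * v21"
    by (rule that)
  obtain u22 v22 where 22: "?A $ 2 $ 2 = L 2 ^ n2 * (?C2 + L 2 * u22) + L 3 * v22"
  proof (rule that)
    have "D 2 (f $ 2) = L 2 ^ n2 * (of_nat (Suc n2) * (Const c2 * L 1 ^ l + L 2 * p2)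
        + L 2 * D 2 (Const c2 * L 1 ^ l + L 2 * p2)) + L 3 * D 2 q2"
      unfolding f2 D_add[of _ "L 2 ^ Suc n2 * _"] D_L_same_power by (simp add: D3)
    also have "\<dots> = L 2 ^ n2 * (?C2 + L 2 * (of_nat (Suc n2) * p2 + D 2 (Const c2 * L 1 ^ l + L 2 * p2)))
        + L 3 * D 2 q2"
      by (simp add: algebra_simps)
    finally show "?A $ 2 $ 2 = \<dots>" by (simp only: J)
  qed
  have 3: "\<exists>w. ?A $ 3 $ k = L 3 ^ Suc n3 * w" if "k \<noteq> 3" for k
    using that unfolding J f3 by (subst D_L_other_power) auto
  then obtain w31 where 31: "?A $ 3 $ 1 = L 3 ^ Suc n3 * w31" by fastforce
  from 3 obtain w32 where 32: "?A $ 3 $ 2 = L 3 ^ Suc n3 * w32" by fastforce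
  obtain w33 where 33: "?A $ 3 $ 3 = L 3 ^ n3 * (?C3 + L 3 * w33)"
  proof (rule that)
    have "D 3 (f $ 3) = L 3 ^ n3 * (of_nat (Suc n3) * (Const c3 * L 1 ^ r * L 2 ^ s + L 3 * q3)
        + L 3 * D 3 (Const c3 * L 1 ^ r * L 2 ^ s + L 3 * q3))"
      unfolding f3 D_L_same_power ..
    also have "\<dots> = L 3 ^ n3 * (?C3 + L 3 * (of_nat (Suc n3) * q3 + D 3 (Const c3 * L 1 ^ r * L 2 ^ s + L 3 * q3)))"
      by (simp add: algebra_simps)
    finally show "?A $ 3 $ 3 = \<dots>" by (simp only: J)
  qed
  \<comment> \<open>The leading two-by-two minor, up to multiples of \<open>L 3\<close>.\<close>
  let ?y = "?A $ 1 $ 2"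
  obtain z where minor: "?A $ 1 $ 1 * ?A $ 2 $ 2 - ?y * ?A $ 2 $ 1
      = L 2 ^ n2 * (?C1 * ?C2 + L 2 * (?C1 * u22 + u * ?C2 + u * L 2 * u22 - ?y * u21)) + L 3 * z"
    by (rule that[of "?C1 * v22 + L 2 * u * v22 + v * (L 2 ^ n2 * (?C2 + L 2 * u22) + L 3 * v22) - ?y * v21"])
      (simp add: 11 21 22 algebra_simps)
  define x where "x = ?C1 * u22 + u * ?C2 + u * L 2 * u22 - ?y * u21"
  define z' where "z' = ?A $ 1 $ 2 * ?A $ 2 $ 3 * w31 + ?A $ 1 $ 3 * ?A $ 2 $ 1 * w32
    - ?A $ 1 $ 1 * ?A $ 2 $ 3 * w32 - ?A $ 1 $ 3 * ?A $ 2 $ 2 * w31"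
  have "det ?A = (?A $ 1 $ 1 * ?A $ 2 $ 2 - ?y * ?A $ 2 $ 1) * ?A $ 3 $ 3 + L 3 ^ Suc n3 * z'"
    by (simp add: det_3 31 32 z'_def algebra_simps)
  also have "\<dots> = L 3 ^ n3 * ((L 2 ^ n2 * (?C1 * ?C2 + L 2 * x) + L 3 * z) * (?C3 + L 3 * w33) + L 3 * z')"
    unfolding minor x_def[symmetric] 33 by (simp add: algebra_simps)
  also have "\<dots> = L 3 ^ n3 * (L 2 ^ (n2 + s) * (Const
          (of_nat (Suc n1) * c1 * (of_nat (Suc n2) * c2) * (of_nat (Suc n3) * c3))
        * L 1 ^ (n1 + l + r) + L 2 * (x * of_nat (Suc n3) * Const c3 * L 1 ^ r))
      + L 3 * (L 2 ^ n2 * (?C1 * ?C2 + L 2 * x) * w33 + z * ?C3 + z * L 3 * w33 + z'))"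
    unfolding Const_mult Const_of_nat power_add by (simp add: algebra_simps del: of_nat_Suc)
  also have "\<dots> \<noteq> 0"
  proof -
    have "of_nat (Suc n1) * c1 * (of_nat (Suc n2) * c2) * (of_nat (Suc n3) * c3) \<noteq> 0"
      using c by (simp del: of_nat_Suc)
    from linear_combination_L2_L3_nonzero[OF this] show ?thesis
      by (simp only: mult_eq_0_iff power_not_zero[OF L_nonzero]) blast
  qed
  finally show ?thesis .
qed

subsection \<open>The integral formula\<close>

text \<open>Modulo \<open>u\<close>, a zero of the integrand at \<open>u\<close> becomes a zero at \<open>0\<close>.\<close>

lemma linear_power_expand:
  fixes u :: "'k poly3"
  shows "\<exists>t. [:- u, 1:] ^ n = [:0, 1:] ^ n + smult u t"
proof (induction n)
  case 0
  show ?case by (intro exI[of _ 0]) simp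
next
  case (Suc n)
  then obtain t where t: "[:- u, 1:] ^ n = [:0, 1:] ^ n + smult u t" by blast
  have u: "[:- u, 1:] = [:0, 1:] + smult u [:- 1:]" by simp
  have "[:- u, 1:] ^ Suc n = [:0, 1:] ^ Suc n + smult u ([:0, 1:] * t - [:0, 1:] ^ n - smult u t)"
    unfolding power_Suc t by (subst u) (simp add: algebra_simps smult_add_right smult_diff_right)
  then show ?case by blast
qed

lemma integ_linear_power_expand:
  fixes u :: "'k poly3"
  obtains t where "poly (integ ([:- u, 1:] ^ n * r)) x = poly (integ ([:0, 1:] ^ n * r)) x + u * t"
proof -
  obtain t where "[:- u, 1:] ^ n = [:0, 1:] ^ n + smult u t"
    using linear_power_expand by metis
  then have "poly (integ ([:- u, 1:] ^ n * r)) x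
      = poly (integ ([:0, 1:] ^ n * r)) x + u * poly (integ (t * r)) x"
    by (simp add: distrib_right integ_add integ_smult)
  then show thesis by (rule that)
qed

text \<open>The product of the powers \<open>(t - L j) ^ a j\<close> as a polynomial in the new variable \<open>t\<close>.\<close>

definition integrand :: "(3 \<Rightarrow> nat) \<Rightarrow> 'k poly3 poly" where
  "integrand a = (\<Prod>j\<in>UNIV. [:- L j, 1:] ^ a j)"

text \<open>
  The components of the universal derivation: the integrals of this product over \<open>t\<close> from \<open>0\<close>
  to \<open>L i\<close>.
\<close>

definition integral_der :: "(3 \<Rightarrow> nat) \<Rightarrow> 'k poly3 ^ 3" where
  "integral_der a = (\<chi> i. poly (integ (integrand a)) (L i))"

lemma homogeneous_poly_integral_der:
  "homogeneous_poly (Suc (a 1 + a 2 + a 3)) (integral_der a $ i)"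
proof -
  have "homogeneous_uni (n * 1) ([:- L j, 1:] ^ n)" for j n
    by (intro homogeneous_uni_power homogeneous_uni_linear homogeneous_poly_minus homogeneous_poly_L)
  then have "homogeneous_uni (a 1 * 1 + a 2 * 1 + a 3 * 1) (integrand a)"
    unfolding integrand_def prod_UNIV_3 by (intro homogeneous_uni_mult)
  then show ?thesis
    using homogeneous_poly_integ[OF _ homogeneous_poly_L] by (simp add: integral_der_def)
qed

lemma integral_der_in_mlog:
  assumes "\<And>i j. (i, j) \<in> pairs \<Longrightarrow> b i j = a i + a j"
  shows "integral_der a \<in> mlog (\<lambda>i. a i + 1) (\<lambda>i j. b i j + 1)"
proof -
  have "L i ^ (a i + 1) dvd integral_der a $ i" for i
  proof -
    have "integrand a = [:- L i, 1:] ^ a i * [:- 0, 1:] ^ 0 * (\<Prod>j\<in>UNIV - {i}. [:- L j, 1:] ^ a j)"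
      unfolding integrand_def by (subst prod.remove[of _ i]) simp_all
    from integ_endpoint_zeros[OF this] show ?thesis by (simp add: integral_der_def)
  qed
  moreover have "(L i - L j) ^ (b i j + 1) dvd integral_der a $ i - integral_der a $ j"
    if "(i, j) \<in> pairs" for i j
  proof -
    have "i \<noteq> j" using that by (auto simp: pairs_def)
    then have "integrand a = [:- L i, 1:] ^ a i * [:- L j, 1:] ^ a j * (\<Prod>l\<in>UNIV - {i} - {j}. [:- L l, 1:] ^ a l)"
      unfolding integrand_def
      by (subst prod.remove[of _ i], simp, simp, subst prod.remove[of _ j]) (simp_all add: mult.assoc)
    from integ_endpoint_zeros[OF this] show ?thesis
      by (simp add: integral_der_def assms[OF that] del: power_Suc)
  qed
  ultimately show ?thesis by (auto simp: mlog_def)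
qed

text \<open>
  The leading monomials are \<open>L 1 ^ (a 1 + a 2 + a 3 + 1)\<close>, \<open>L 1 ^ a 1 * L 2 ^ (a 2 + a 3 + 1)\<close> and
  \<open>L 1 ^ a 1 * L 2 ^ a 2 * L 3 ^ (a 3 + 1)\<close>.
\<close>

lemma det_jacobian_integral_der: "det (jacobian (integral_der a)) \<noteq> 0"
proof -
  let ?l = "\<lambda>j. [:- L j, 1:] :: 'k poly3 poly" and ?t = "[:0, 1:] :: 'k poly3 poly"
  have f: "integral_der a $ i = poly (integ (?l 3 ^ a 3 * (?l 1 ^ a 1 * ?l 2 ^ a 2))) (L i)" for i
    by (simp add: integral_der_def integrand_def prod_UNIV_3 mult_ac)
  have sgn: "(- L j) ^ n = Const ((- 1) ^ n) * L j ^ n" for j n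
    by (simp add: Const_power Const_minus power_minus[of "L j"])
  \<comment> \<open>The first two components modulo \<open>L 3\<close>, then the first one modulo \<open>L 2\<close>.\<close>
  obtain q1 where q1: "integral_der a $ 1 = poly (integ (?t ^ a 3 * (?l 1 ^ a 1 * ?l 2 ^ a 2))) (L 1) + L 3 * q1"
    unfolding f by (rule integ_linear_power_expand)
  obtain q2 where q2: "integral_der a $ 2 = poly (integ (?t ^ a 3 * (?l 1 ^ a 1 * ?l 2 ^ a 2))) (L 2) + L 3 * q2"
    unfolding f by (rule integ_linear_power_expand)
  obtain p1 where "poly (integ (?l 2 ^ a 2 * (?t ^ a 3 * ?l 1 ^ a 1))) (L 1)
      = poly (integ (?t ^ a 2 * (?t ^ a 3 * ?l 1 ^ a 1))) (L 1) + L 2 * p1"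
    by (rule integ_linear_power_expand)
  then have p1: "poly (integ (?t ^ a 3 * (?l 1 ^ a 1 * ?l 2 ^ a 2))) (L 1)
      = poly (integ (?l 1 ^ a 1 * ?t ^ (a 2 + a 3) * 1)) (L 1) + L 2 * p1"
    by (simp only: power_add mult_ac mult_1_left)
  obtain c1 where c1: "c1 \<noteq> 0" "integ01 ([:- 1, 1:] ^ a 1 * [:0, 1:] ^ (a 2 + a 3)) = Const (c1 :: 'k)"
    using integ01_beta by blast
  have f1: "integral_der a $ 1 = Const c1 * L 1 ^ Suc (a 1 + (a 2 + a 3)) + L 2 * p1 + L 3 * q1"
    using integ_endpoint_zeros[of _ "L 1" "a 1" 0 "a 2 + a 3" 1, OF refl]
    by (simp add: q1 p1 c1(2) pcompose_1)
  obtain c2 p2 where c2: "c2 \<noteq> 0" "poly (integ (?l 2 ^ a 2 * ?t ^ a 3 * ?l 1 ^ a 1)) (L 2)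
      = L 2 ^ (a 2 + a 3 + 1) * (Const c2 * poly (?l 1 ^ a 1) 0 + L 2 * p2)"
    by (rule integ_leading_term)
  have f2: "integral_der a $ 2 = L 2 ^ Suc (a 2 + a 3)
      * (Const (c2 * (- 1) ^ a 1) * L 1 ^ a 1 + L 2 * p2) + L 3 * q2"
    using c2(2) by (simp add: q2 mult_ac poly_power sgn Const_mult)
  obtain c3 q3 where c3: "c3 \<noteq> 0" "poly (integ (?l 3 ^ a 3 * ?t ^ 0 * (?l 1 ^ a 1 * ?l 2 ^ a 2))) (L 3)
      = L 3 ^ (a 3 + 0 + 1) * (Const c3 * poly (?l 1 ^ a 1 * ?l 2 ^ a 2) 0 + L 3 * q3)"
    by (rule integ_leading_term)
  have f3: "integral_der a $ 3 = L 3 ^ Suc (a 3)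
      * (Const (c3 * ((- 1) ^ a 1 * (- 1) ^ a 2)) * L 1 ^ a 1 * L 2 ^ a 2 + L 3 * q3)"
    using c3(2) by (simp add: f poly_power sgn Const_mult mult_ac)
  show ?thesis
    by (rule det_jacobian_nonzero[OF f1 f2 f3]) (use c1 c2 c3 in simp_all)
qed

lemma integral_der_universal:
  assumes b: "\<And>i j. (i, j) \<in> pairs \<Longrightarrow> b i j = a i + a j"
  shows "bij_betw ((*v) (jacobian (integral_der a))) UNIV (mlog a b)"
proof -
  let ?A = "jacobian (integral_der a)" and ?d = "a 1 + a 2 + a 3"
  have cols: "(\<chi> i. ?A $ i $ k) \<in> mlog a b" for k
  proof -
    have "D k f - D k g = D k (f - g)" for f g
      by (simp add: D_def der_apply_diff)
    moreover have "integral_der a \<in> mlog (\<lambda>i. a i + 1) (\<lambda>i j. b i j + 1)"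
      by (rule integral_der_in_mlog) (rule b)
    ultimately show ?thesis
      by (auto simp: mlog_def jacobian_def D_def intro!: power_dvd_der_apply)
  qed
  then obtain c where c: "det ?A = Q a b * c" using Q_dvd_det by blast
  have "homogeneous_poly ?d (?A $ i $ k)" for i k
    using homogeneous_poly_D[OF homogeneous_poly_integral_der[where a = a and i = i], where k = k] by (simp add: jacobian_def)
  then have "homogeneous_poly (3 * ?d) (Q a b * c)"
    unfolding c [symmetric] by (rule homogeneous_poly_det)
  moreover have "a 1 + a 2 + a 3 + b 1 2 + b 2 3 + b 1 3 = 3 * ?d"
    by (simp add: b pairs_def)
  then have "homogeneous_poly (3 * ?d) (Q a b)" using homogeneous_poly_Q[of a b] by (simp only:)
  ultimately obtain c0 where "c = Const c0"
    using homogeneous_quotient_Const Q_nonzero by metis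
  moreover from this have "c0 \<noteq> 0" using det_jacobian_integral_der[of a] c by auto
  ultimately show ?thesis using saito_criterion[OF cols, of c0] c by simp
qed

lemma integral_der_nonzero: "integral_der a \<noteq> 0"
proof
  assume "integral_der a = 0"
  then have "jacobian (integral_der a) = 0"
    by (simp add: jacobian_def D_def vec_eq_iff)
  then show False using det_jacobian_integral_der[of a] by (simp add: det_3)
qed

end

section \<open>Logarithmic derivations in adapted coordinates\<close>

lemma Const_mult_dvd_iff:
  fixes c :: "'k::field"
  assumes "c \<noteq> 0" shows "Const c * f dvd g \<longleftrightarrow> f dvd g"
proof
  assume "f dvd g"
  then obtain h where "g = f * h" by blast
  moreover have "Const c * f * (Const (inverse c) * h) = f * (Const (inverse c) * (Const c * h))"
    by (simp only: mult_ac)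
  ultimately have "g = Const c * f * (Const (inverse c) * h)"
    by (simp only: Const_inverse_cancel_left[OF assms])
  then show "Const c * f dvd g" by simp
qed (rule dvd_mult_right)

lemma dvd_Const_mult_iff:
  fixes c :: "'k::field"
  assumes "c \<noteq> 0" shows "f dvd Const c * g \<longleftrightarrow> f dvd g"
proof
  assume "f dvd Const c * g"
  then have "f dvd Const (inverse c) * (Const c * g)" by (rule dvd_mult)
  then show "f dvd g" unfolding Const_inverse_cancel_left[OF assms] .
qed simp

lemma proportional_if_linform_ker_eq:
  fixes a p :: "'k::field ^ 3"
  assumes ker: "linform_ker a = linform_ker p" and "p \<noteq> 0"
  obtains c where "c \<noteq> 0" "a = c *s p"
proof -
  obtain v where v: "(\<Sum>i\<in>UNIV. p $ i * v $ i) = 1" using obtain_dual_vector assms(2) by metis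
  define c where "c = (\<Sum>i\<in>UNIV. a $ i * v $ i)"
  have "v \<notin> linform_ker p" using v by (simp add: linform_ker_def)
  then have "c \<noteq> 0" using ker by (auto simp: linform_ker_def c_def)
  have "a $ j = c * p $ j" for j
  proof -
    have 1: "(\<Sum>i\<in>UNIV. u $ i * (axis j 1 - p $ j *s v) $ i) = u $ j - p $ j * (\<Sum>i\<in>UNIV. u $ i * v $ i)"
      for u :: "'k ^ 3"
    proof -
      have "(\<Sum>i\<in>UNIV. u $ i * axis j 1 $ i) = u $ j"
        by (simp add: axis_def if_distrib cong: if_cong)
      then show ?thesis
        by (simp add: right_diff_distrib sum_subtractf sum_distrib_left mult_ac)
    qed
    have "axis j 1 - p $ j *s v \<in> linform_ker p"
      unfolding linform_ker_def mem_Collect_eq 1 v by simp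
    then have "axis j 1 - p $ j *s v \<in> linform_ker a" using ker by simp
    then show ?thesis unfolding linform_ker_def mem_Collect_eq 1 by (simp add: c_def mult.commute)
  qed
  then have "a = c *s p" by (simp add: vec_eq_iff)
  then show thesis using \<open>c \<noteq> 0\<close> that by blast
qed

lemma linform_power_dvd_cong:
  fixes a p :: "'k::field ^ 3"
  assumes "linform_ker a = linform_ker p" "p \<noteq> 0"
  shows "linform_poly a ^ n dvd der_apply \<theta> (linform_poly a)
    \<longleftrightarrow> linform_poly p ^ n dvd der_apply \<theta> (linform_poly p)"
proof -
  obtain c where c: "c \<noteq> 0" "a = c *s p"
    using proportional_if_linform_ker_eq[OF assms] by metis
  have "linform_poly a ^ n = Const (c ^ n) * linform_poly p ^ n"
    by (simp add: c(2) linform_poly_scale power_mult_distrib Const_power)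
  moreover have "der_apply \<theta> (linform_poly a) = Const c * der_apply \<theta> (linform_poly p)"
    by (simp add: c(2) linform_poly_scale der_apply_mult)
  ultimately show ?thesis
    using c(1) by (simp add: Const_mult_dvd_iff dvd_Const_mult_iff)
qed

lemma linform_ker_minus: "linform_ker (- a) = linform_ker a"
  by (simp add: linform_ker_def sum_negf)

lemma linform_ker_diff_commute: "linform_ker (a - b) = linform_ker (b - a)"
  using linform_ker_minus[of "a - b"] by simp

lemma module_hom_nabla: "module_hom (*s) (*s) (\<lambda>\<phi>. nabla \<phi> \<theta>)"
  by unfold_locales
    (simp_all add: nabla_def der_apply_def vec_eq_iff distrib_left distrib_right sum.distrib
      sum_distrib_left mult_ac)

context adapted_coordinates begin

text \<open>The planes \<open>L i = 0\<close> and \<open>L i = L j\<close>.\<close>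

abbreviation P :: "3 \<Rightarrow> ('k ^ 3) set" where
  "P i \<equiv> linform_ker (B $ i)"

abbreviation R :: "3 \<Rightarrow> 3 \<Rightarrow> ('k ^ 3) set" where
  "R i j \<equiv> linform_ker (B $ i - B $ j)"

definition planes :: "'k arrangement" where
  "planes = {P 1, P 2, P 3, R 1 2, R 2 3, R 1 3}"

lemma log_der_iff_mlog:
  assumes "defining_forms planes \<alpha>"
  shows "\<theta> \<in> log_der planes \<alpha> \<mu> \<longleftrightarrow> coords \<theta> \<in> mlog (\<lambda>i. \<mu> (P i)) (\<lambda>i j. \<mu> (R i j))"
proof -
  have P: "linform_poly (\<alpha> (P i)) ^ n dvd der_apply \<theta> (linform_poly (\<alpha> (P i)))
      \<longleftrightarrow> L i ^ n dvd coords \<theta> $ i" for i n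
  proof -
    have "P i \<in> planes" using exhaust_3[of i] by (auto simp: planes_def)
    then have "linform_ker (\<alpha> (P i)) = P i" using assms by (simp add: defining_forms_def)
    from linform_power_dvd_cong[OF this B_nonzero] show ?thesis by (simp add: L_def coords_def)
  qed
  have R: "linform_poly (\<alpha> (R i j)) ^ n dvd der_apply \<theta> (linform_poly (\<alpha> (R i j)))
      \<longleftrightarrow> (L i - L j) ^ n dvd coords \<theta> $ i - coords \<theta> $ j" if "(i, j) \<in> pairs" for i j n
  proof -
    have "R i j \<in> planes" using that by (auto simp: planes_def pairs_def)
    then have ker: "linform_ker (\<alpha> (R i j)) = R i j" using assms by (simp add: defining_forms_def)
    have nonzero: "B $ i - B $ j \<noteq> 0" by (rule B_diff_nonzero) (use that in \<open>auto simp: pairs_def\<close>)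
    have eq: "coords \<theta> $ i - coords \<theta> $ j = der_apply \<theta> (linform_poly (B $ i - B $ j))"
      by (simp add: coords_def der_apply_diff flip: L_diff)
    show ?thesis unfolding eq L_diff by (rule linform_power_dvd_cong[OF ker nonzero])
  qed
  show ?thesis
    using R[of 1 2] R[of 2 3] R[of 1 3]
    by (simp add: log_der_def mlog_def planes_def P pairs_def forall_3 conj_ac)
qed

lemma universal_der_iff:
  assumes "defining_forms planes \<alpha>"
  shows "universal_der planes \<alpha> m \<theta> \<longleftrightarrow>
    coords \<theta> \<in> mlog (\<lambda>i. m (P i) + 1) (\<lambda>i j. m (R i j) + 1) \<and> (\<exists>k. homogeneous_der k \<theta>) \<and>
    bij_betw ((*v) (jacobian (coords \<theta>))) UNIV (mlog (\<lambda>i. m (P i)) (\<lambda>i j. m (R i j)))"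
proof -
  let ?mlog = "mlog (\<lambda>i. m (P i)) (\<lambda>i j. m (R i j))"
  have vimage: "log_der planes \<alpha> m = coords -` ?mlog"
    by (auto simp: log_der_iff_mlog[OF assms])
  have c: "bij_betw coords (log_der planes \<alpha> m) ?mlog"
  proof (rule bij_betw_imageI)
    show "inj_on coords (log_der planes \<alpha> m)"
      using bij_coords by (auto simp: bij_def intro: inj_on_subset)
    show "coords ` log_der planes \<alpha> m = ?mlog"
      unfolding vimage by (rule surj_image_vimage_eq[OF bij_is_surj[OF bij_coords]])
  qed
  have "bij_betw (\<lambda>\<phi>. nabla \<phi> \<theta>) UNIV (log_der planes \<alpha> m)
      \<longleftrightarrow> bij_betw (coords \<circ> (\<lambda>\<phi>. nabla \<phi> \<theta>)) UNIV ?mlog"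
  proof
    assume "bij_betw (\<lambda>\<phi>. nabla \<phi> \<theta>) UNIV (log_der planes \<alpha> m)"
    then show "bij_betw (coords \<circ> (\<lambda>\<phi>. nabla \<phi> \<theta>)) UNIV ?mlog" using c by (rule bij_betw_trans)
  next
    assume *: "bij_betw (coords \<circ> (\<lambda>\<phi>. nabla \<phi> \<theta>)) UNIV ?mlog"
    have "nabla \<phi> \<theta> \<in> log_der planes \<alpha> m" for \<phi>
      using bij_betwE[OF *] by (simp add: log_der_iff_mlog[OF assms])
    then show "bij_betw (\<lambda>\<phi>. nabla \<phi> \<theta>) UNIV (log_der planes \<alpha> m)"
      using * bij_betw_comp_iff2[OF c, of "\<lambda>\<phi>. nabla \<phi> \<theta>" UNIV] by blast
  qed
  also have "coords \<circ> (\<lambda>\<phi>. nabla \<phi> \<theta>) = ((*v) (jacobian (coords \<theta>))) \<circ> coords"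
    by (simp add: fun_eq_iff coords_nabla)
  also have "bij_betw (((*v) (jacobian (coords \<theta>))) \<circ> coords) UNIV ?mlog
      \<longleftrightarrow> bij_betw ((*v) (jacobian (coords \<theta>))) UNIV ?mlog"
    by (rule bij_betw_comp_iff[OF bij_coords, symmetric])
  finally show ?thesis
    by (simp add: universal_der_def module_hom_nabla log_der_iff_mlog[OF assms])
qed

lemma homogeneous_der_coords: "homogeneous_der k \<theta> \<Longrightarrow> homogeneous_poly k (coords \<theta> $ i)"
  by (cases "coords \<theta> $ i = 0") (auto simp: homogeneous_der_def coords_def L_def)

lemma homogeneous_derI:
  assumes "\<theta> \<noteq> 0" "\<And>i. homogeneous_poly k (coords \<theta> $ i)" shows "homogeneous_der k \<theta>"
proof -
  have "homogeneous_poly k (\<theta> $ j)" for j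
    unfolding inverse_coords[of j \<theta>, symmetric]
    by (intro homogeneous_poly_sum homogeneous_poly_Const_mult assms)
  then show ?thesis
    using assms(1) unfolding homogeneous_der_def der_apply_linform
    by (auto intro!: homogeneous_poly_sum homogeneous_poly_Const_mult)
qed

text \<open>The characterization for the arrangement in adapted coordinates.\<close>

theorem universal_der_exists_iff:
  assumes "defining_forms planes \<alpha>"
    and ge: "\<And>i j. (i, j) \<in> pairs \<Longrightarrow> m (P i) + m (P j) \<le> m (R i j)"
  shows "(\<exists>\<theta>. universal_der planes \<alpha> m \<theta>) \<longleftrightarrow> (\<forall>(i, j)\<in>pairs. m (R i j) = m (P i) + m (P j))"
proof
  assume "\<exists>\<theta>. universal_der planes \<alpha> m \<theta>"
  then obtain \<theta> k where \<theta>: "homogeneous_der k \<theta>"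
    "bij_betw ((*v) (jacobian (coords \<theta>))) UNIV (mlog (\<lambda>i. m (P i)) (\<lambda>i j. m (R i j)))"
    unfolding universal_der_iff[OF assms(1)] by blast
  from equalities_if_generators[OF homogeneous_der_coords[OF \<theta>(1)] bij_betw_imp_surj_on[OF \<theta>(2)] ge]
  show "\<forall>(i, j)\<in>pairs. m (R i j) = m (P i) + m (P j)" by auto
next
  assume "\<forall>(i, j)\<in>pairs. m (R i j) = m (P i) + m (P j)"
  then have eq: "m (R i j) = m (P i) + m (P j)" if "(i, j) \<in> pairs" for i j using that by blast
  let ?f = "integral_der (\<lambda>i. m (P i))"
  obtain \<theta> where \<theta>: "coords \<theta> = ?f" using surjD[OF bij_is_surj[OF bij_coords], of ?f] by auto
  have "homogeneous_poly (Suc (m (P 1) + m (P 2) + m (P 3))) (coords \<theta> $ i)" for i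
    unfolding \<theta> by (rule homogeneous_poly_integral_der)
  moreover have "\<theta> \<noteq> 0"
  proof
    assume "\<theta> = 0"
    then have "?f = 0" using \<theta> by (simp add: vec_eq_iff coords_nth flip: \<theta>)
    then show False using integral_der_nonzero by blast
  qed
  ultimately have "\<exists>k. homogeneous_der k \<theta>"
    using homogeneous_derI by blast
  moreover have "?f \<in> mlog (\<lambda>i. m (P i) + 1) (\<lambda>i j. m (R i j) + 1)"
    by (rule integral_der_in_mlog) (rule eq)
  moreover have "bij_betw ((*v) (jacobian ?f)) UNIV (mlog (\<lambda>i. m (P i)) (\<lambda>i j. m (R i j)))"
    by (rule integral_der_universal) (rule eq)
  ultimately show "\<exists>\<theta>. universal_der planes \<alpha> m \<theta>"
    unfolding universal_der_iff[OF assms(1)] \<theta>[symmetric] by blast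
qed

section \<open>Combinatorics of the arrangement\<close>

text \<open>The vector with the coordinates \<open>c\<close> is \<open>V *v c\<close>.\<close>

lemma mem_P: "V *v c \<in> P i \<longleftrightarrow> c $ i = 0"
proof -
  have "B *v (V *v c) = c" by (simp add: matrix_vector_mul_assoc BV)
  then have "(B *v (V *v c)) $ i = c $ i" by simp
  then show ?thesis by (simp add: linform_ker_def matrix_vector_mult_def)
qed

lemma mem_R: "V *v c \<in> R i j \<longleftrightarrow> c $ i = c $ j"
proof -
  have "B *v (V *v c) = c" by (simp add: matrix_vector_mul_assoc BV)
  then have "(B *v (V *v c)) $ i = c $ i" "(B *v (V *v c)) $ j = c $ j" by simp_all
  then show ?thesis
    by (simp add: linform_ker_def matrix_vector_mult_def left_diff_distrib sum_subtractf)
qed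

lemma P_eq_iff: "P i = P j \<longleftrightarrow> i = j"
  using mem_P[of "axis i 1" i] mem_P[of "axis i 1" j] by (auto simp: axis_def split: if_splits)

lemma P_neq_R: "P i \<noteq> R j k"
  using mem_P[of "\<chi> i. 1" i] mem_R[of "\<chi> i. 1" j k] by auto

lemma subset_iff_coordinates: "S \<subseteq> T \<longleftrightarrow> (\<forall>c. V *v c \<in> S \<longrightarrow> V *v c \<in> T)"
proof -
  have "V *v (B *v w) = w" for w by (simp add: matrix_vector_mul_assoc VB)
  then show ?thesis by (metis subset_iff)
qed

text \<open>
  The intersection of the planes \<open>L i = 0\<close> and \<open>L j = L k\<close> is a line; these are the coordinates of
  a vector that spans it.  The line lies in a third plane if and only if \<open>i\<close> is \<open>j\<close> or \<open>k\<close>.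
\<close>

definition line_dir :: "3 \<Rightarrow> 3 \<Rightarrow> 3 \<Rightarrow> 'k ^ 3" where
  "line_dir i j k = (\<chi> l. if l = i \<or> i \<in> {j, k} \<and> l \<in> {j, k} then 0 else 1)"

lemma
  assumes "(j, k) \<in> pairs"
  shows P_R_subset_P: "P i \<inter> R j k \<subseteq> P l \<longleftrightarrow> line_dir i j k $ l = 0"
    and P_R_subset_R: "P i \<inter> R j k \<subseteq> R l l' \<longleftrightarrow> line_dir i j k $ l = line_dir i j k $ l'"
proof -
  have jk: "j \<noteq> k" using assms by (auto simp: pairs_def)
  have in_line: "V *v line_dir i j k \<in> P i \<inter> R j k"
    by (auto simp: mem_P mem_R line_dir_def)
  have cover: "l = j \<or> l = k \<or> l = i" if "i \<notin> {j, k}" for l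
    using that assms exhaust_3[of l] exhaust_3[of i] by (auto simp: pairs_def)
  have cover': "l = l'" if "i \<in> {j, k}" "l \<notin> {j, k}" "l' \<notin> {j, k}" for l l'
    using that assms exhaust_3[of l] exhaust_3[of l'] by (auto simp: pairs_def)
  show "P i \<inter> R j k \<subseteq> P l \<longleftrightarrow> line_dir i j k $ l = 0"
  proof
    show "P i \<inter> R j k \<subseteq> P l \<Longrightarrow> line_dir i j k $ l = 0" using in_line mem_P by blast
    assume "line_dir i j k $ l = 0"
    then show "P i \<inter> R j k \<subseteq> P l"
      by (auto simp: subset_iff_coordinates mem_P mem_R line_dir_def split: if_splits)
  qed
  show "P i \<inter> R j k \<subseteq> R l l' \<longleftrightarrow> line_dir i j k $ l = line_dir i j k $ l'"
  proof
    show "P i \<inter> R j k \<subseteq> R l l' \<Longrightarrow> line_dir i j k $ l = line_dir i j k $ l'"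
      using in_line mem_R by blast
    assume *: "line_dir i j k $ l = line_dir i j k $ l'"
    show "P i \<inter> R j k \<subseteq> R l l'"
    proof (cases "i \<in> {j, k}")
      case True
      then show ?thesis
        using * cover'[of l l']
        by (auto simp: subset_iff_coordinates mem_P mem_R line_dir_def split: if_splits)
    next
      case False
      then show ?thesis
        using * cover[of l] cover[of l']
        by (auto simp: subset_iff_coordinates mem_P mem_R line_dir_def split: if_splits)
    qed
  qed
qed

lemma Collect_insert:
  "{x \<in> insert a S. p x} = (if p a then insert a {x \<in> S. p x} else {x \<in> S. p x})"
  by auto

lemma pairs_cases:
  "(j, k) \<in> pairs \<longleftrightarrow> j = 1 \<and> k = 2 \<or> j = 2 \<and> k = 3 \<or> j = 1 \<and> k = 3"
  by (auto simp: pairs_def)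

lemma localization_double:
  assumes "(j, k) \<in> pairs" "i \<notin> {j, k}"
  shows "localization planes (P i \<inter> R j k) = {P i, R j k}"
  using assms exhaust_3[of i]
  unfolding pairs_cases localization_def planes_def Collect_insert
  by (elim disjE conjE) (simp_all add: P_R_subset_P P_R_subset_R pairs_def line_dir_def)

lemma localization_triple:
  assumes "(j, k) \<in> pairs" "i \<in> {j, k}"
  shows "localization planes (P i \<inter> R j k) \<noteq> {P i, R j k}"
proof -
  have "P j \<in> localization planes (P i \<inter> R j k)" "P k \<in> localization planes (P i \<inter> R j k)"
    using assms by (auto simp: localization_def planes_def P_R_subset_P line_dir_def pairs_cases)
  then show ?thesis using assms by (auto simp: P_eq_iff P_neq_R pairs_def)
qed

lemma planes_through_triple:
  assumes "(j, k) \<in> pairs" "i \<in> {j, k}"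
  shows "{H. H \<in> {P 1, P 2, P 3} \<and> P i \<inter> R j k \<subseteq> H} = {P j, P k}"
proof -
  have "i = j \<or> i = k" using assms(2) by simp
  then show ?thesis
    using assms(1) unfolding pairs_cases Collect_insert
    by (elim disjE conjE) (simp_all add: P_R_subset_P pairs_def line_dir_def)
qed

lemma multiplicity_bound_triple:
  assumes "(j, k) \<in> pairs" "i \<in> {j, k}"
  shows "(\<Sum>H | H \<in> {P 1, P 2, P 3} \<and> P i \<inter> R j k \<subseteq> H. int (m H + 1)) - 1 = int (m (P j) + m (P k) + 1)"
proof -
  have "P j \<noteq> P k" using assms(1) by (auto simp: P_eq_iff pairs_def)
  then show ?thesis unfolding planes_through_triple[OF assms] by simp
qed

lemma finite_set_eqI6:
  "\<lbrakk>G \<subseteq> {a, b, c, d, e, f}; a \<in> G; b \<in> G; c \<in> G; d \<notin> G; e \<notin> G; f \<notin> G\<rbrakk> \<Longrightarrow> G = {a, b, c}"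
  by blast

text \<open>
  A subarrangement \<open>G\<close> that contains, for any two planes, a plane through their intersection, and
  whose planes have a common nonzero vector, consists of the three planes through one of the four
  triple lines.  It contains one of the two planes through each of the three double lines, and four
  of these eight choices are excluded by the common vector.
\<close>

lemma coatom_cases:
  assumes sub: "G \<subseteq> planes"
    and cover: "\<And>H H'. H \<in> planes \<Longrightarrow> H' \<in> planes \<Longrightarrow> H \<noteq> H' \<Longrightarrow> \<exists>H''\<in>G. H \<inter> H' \<subseteq> H''"
    and w: "w \<noteq> 0" "\<And>H. H \<in> G \<Longrightarrow> w \<in> H"
  shows "G = {R 1 2, R 2 3, R 1 3} \<or> G = {P 1, P 2, R 1 2} \<or> G = {P 2, P 3, R 2 3} \<or> G = {P 1, P 3, R 1 3}"
proof -
  have double: "P i \<in> G \<or> R j k \<in> G" if "(j, k) \<in> pairs" "i \<notin> {j, k}" for i j k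
  proof -
    have "P i \<in> planes" "R j k \<in> planes"
      using that exhaust_3[of i] by (auto simp: planes_def pairs_def)
    then obtain H where H: "H \<in> G" "P i \<inter> R j k \<subseteq> H" using cover P_neq_R by metis
    then have "H \<in> localization planes (P i \<inter> R j k)" using sub by (auto simp: localization_def)
    then show ?thesis using H(1) unfolding localization_double[OF that] by auto
  qed
  have d: "P 1 \<in> G \<or> R 2 3 \<in> G" "P 2 \<in> G \<or> R 1 3 \<in> G" "P 3 \<in> G \<or> R 1 2 \<in> G"
    by (rule double; simp add: pairs_def)+
  define c where "c = B *v w"
  have Vc: "V *v c = w" by (simp add: c_def matrix_vector_mul_assoc VB)
  have "c \<noteq> 0" using w(1) Vc by auto
  then have c0: "c $ 1 \<noteq> 0 \<or> c $ 2 \<noteq> 0 \<or> c $ 3 \<noteq> 0" by (auto simp: vec_eq_iff forall_3)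
  have p: "P i \<in> G \<Longrightarrow> c $ i = 0" for i using w(2) mem_P[of c i] Vc by metis
  have r: "R i j \<in> G \<Longrightarrow> c $ i = c $ j" for i j using w(2) mem_R[of c i j] Vc by metis
  note pr = p[of 1] p[of 2] p[of 3] r[of 1 2] r[of 2 3] r[of 1 3]
  consider "R 1 2 \<in> G" "R 2 3 \<in> G" "R 1 3 \<in> G" | "P 1 \<in> G" "P 2 \<in> G" "R 1 2 \<in> G"
    | "P 2 \<in> G" "P 3 \<in> G" "R 2 3 \<in> G" | "P 1 \<in> G" "P 3 \<in> G" "R 1 3 \<in> G"
    using d c0 pr by metis
  then show ?thesis
  proof cases
    case 1
    have "G = {R 1 2, R 2 3, R 1 3}"
      by (rule finite_set_eqI6[of _ _ _ _ "P 1" "P 2" "P 3"])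
        (use 1 sub c0 pr in \<open>auto simp: planes_def\<close>)
    then show ?thesis by blast
  next
    case 2
    have "G = {P 1, P 2, R 1 2}"
      by (rule finite_set_eqI6[of _ _ _ _ "P 3" "R 2 3" "R 1 3"])
        (use 2 sub c0 pr in \<open>auto simp: planes_def\<close>)
    then show ?thesis by blast
  next
    case 3
    have "G = {P 2, P 3, R 2 3}"
      by (rule finite_set_eqI6[of _ _ _ _ "P 1" "R 1 2" "R 1 3"])
        (use 3 sub c0 pr in \<open>auto simp: planes_def\<close>)
    then show ?thesis by blast
  next
    case 4
    have "G = {P 1, P 3, R 1 3}"
      by (rule finite_set_eqI6[of _ _ _ _ "P 2" "R 1 2" "R 2 3"])
        (use 4 sub c0 pr in \<open>auto simp: planes_def\<close>)
    then show ?thesis by blast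
  qed
qed

lemma image_plane:
  assumes "\<And>c. V *v c \<in> S \<longleftrightarrow> p c" shows "(\<lambda>v. V *v v) ` {c. p c} = S"
proof -
  have "x = V *v (B *v x)" for x by (simp add: matrix_vector_mul_assoc VB)
  then show ?thesis using assms by (auto simp: image_iff) metis
qed

lemma image_A3_standard: "(\<lambda>H. (\<lambda>v. V *v v) ` H) ` A3_standard = planes"
  unfolding A3_standard_def planes_def image_insert image_empty
    image_plane[OF mem_P] image_plane[OF mem_R] ..

end

lemma type_A3_obtain_coordinates:
  assumes "type_A3 \<A>"
  obtains B V where "B ** V = mat 1" "\<A> = adapted_coordinates.planes B"
proof -
  obtain M :: "'a ^ 3 ^ 3" where M: "invertible M" "\<A> = (\<lambda>H. (\<lambda>v. M *v v) ` H) ` A3_standard"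
    using assms unfolding type_A3_def by blast
  then obtain N where N: "N ** M = mat 1" by (auto simp: invertible_def)
  then interpret adapted_coordinates N M by unfold_locales
  show thesis using that[OF N] image_A3_standard M(2) by simp
qed

text \<open>
  Coordinates in which the coatom of a supersolvable filtration consists of the planes
  \<open>L i = L j\<close>.  If the coatom is another triple of planes, one of the remaining planes takes the
  role of \<open>L 1 = 0\<close>; in terms of four points on a line, another point is moved to the origin.
\<close>

lemma supersolvable_obtain_coordinates:
  fixes \<A> :: "'k::field_char_0 arrangement"
  assumes "type_A3 \<A>" "supersolvable_filtration \<A> 3 F"
  obtains B V where "B ** V = mat 1" "\<A> = adapted_coordinates.planes B"
    "F 2 = {linform_ker (B $ 1 - B $ 2), linform_ker (B $ 2 - B $ 3), linform_ker (B $ 1 - B $ 3)}"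
proof -
  note result = that
  obtain B V where BV: "B ** V = mat 1" and \<A>: "\<A> = adapted_coordinates.planes B"
    using type_A3_obtain_coordinates[OF assms(1)] .
  interpret adapted_coordinates B V by unfold_locales (rule BV)
  have F: "F 3 = planes" "\<forall>i\<in>{1..<3}. F i \<subset> F (Suc i)" "\<forall>i\<in>{1..3}. arr_rank (F i) = i"
    "\<forall>i\<in>{2..3}. \<forall>H\<in>F i. \<forall>H'\<in>F i. H \<noteq> H' \<longrightarrow> (\<exists>H''\<in>F (i - 1). H \<inter> H' \<subseteq> H'')"
    using assms(2)[unfolded supersolvable_filtration_def \<A>] by - (elim conjE, assumption)+
  have sub: "F 2 \<subseteq> planes" using bspec[OF F(2), of 2] F(1) by simp
  have rank: "arr_rank (F 2) = 2" using bspec[OF F(3), of 2] by simp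
  have cover: "\<exists>H''\<in>F 2. H \<inter> H' \<subseteq> H''" if "H \<in> planes" "H' \<in> planes" "H \<noteq> H'" for H H'
    using bspec[OF F(4), of 3] F(1) that by simp
  have "\<exists>w. w \<noteq> 0 \<and> (\<forall>H\<in>F 2. w \<in> H)"
  proof (rule ccontr)
    assume "\<not> ?thesis"
    then have "\<Inter> (F 2) \<subseteq> {0}" by blast
    then have dim: "vec.dim (\<Inter> (F 2)) = 0" using vec.dim_subset[of "\<Inter> (F 2)" "{0}"] by simp
    show False using rank unfolding arr_rank_def dim vec_dim_card by simp
  qed
  then obtain w where w: "w \<noteq> 0" "\<And>H. H \<in> F 2 \<Longrightarrow> w \<in> H" by blast
  have det: "det B \<noteq> 0" using BV det_mul[of B V] by (auto simp: det_I)
  \<comment> \<open>A change of coordinates with another plane in the role of \<open>L 1 = 0\<close>.\<close>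
  have pivot: thesis
    if "det B' \<noteq> 0" and planes: "planes = {linform_ker (B' $ 1), linform_ker (B' $ 2), linform_ker (B' $ 3),
        linform_ker (B' $ 1 - B' $ 2), linform_ker (B' $ 2 - B' $ 3), linform_ker (B' $ 1 - B' $ 3)}"
      and F2: "F 2 = {linform_ker (B' $ 1 - B' $ 2), linform_ker (B' $ 2 - B' $ 3), linform_ker (B' $ 1 - B' $ 3)}"
    for B'
  proof -
    obtain V' where "B' ** V' = mat 1"
      using \<open>det B' \<noteq> 0\<close> invertible_det_nz invertible_right_inverse by blast
    moreover from this interpret B': adapted_coordinates B' V' by unfold_locales
    have "planes = B'.planes" unfolding planes B'.planes_def ..
    ultimately show thesis using result[of B' V'] \<A> F2 by simp
  qed
  have "F 2 = {R 1 2, R 2 3, R 1 3} \<or> F 2 = {P 1, P 2, R 1 2} \<or> F 2 = {P 2, P 3, R 2 3} \<or> F 2 = {P 1, P 3, R 1 3}"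
    by (rule coatom_cases[OF sub cover w])
  then consider "F 2 = {R 1 2, R 2 3, R 1 3}" | "F 2 = {P 1, P 2, R 1 2}"
    | "F 2 = {P 2, P 3, R 2 3}" | "F 2 = {P 1, P 3, R 1 3}" by (elim disjE)
  then show thesis
  proof cases
    case 1
    then show ?thesis using result[OF BV \<A>] by simp
  next
    case 2
    show ?thesis
    proof (rule pivot)
      show "det (vector [B $ 3, B $ 3 - B $ 2, B $ 3 - B $ 1]) \<noteq> 0"
        using det by (simp add: det_3 algebra_simps)
    qed (simp_all add: 2 planes_def insert_commute linform_ker_diff_commute)
  next
    case 3
    show ?thesis
    proof (rule pivot)
      show "det (vector [B $ 1, B $ 1 - B $ 2, B $ 1 - B $ 3]) \<noteq> 0"
        using det by (simp add: det_3 algebra_simps)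
    qed (simp_all add: 3 planes_def insert_commute linform_ker_diff_commute)
  next
    case 4
    show ?thesis
    proof (rule pivot)
      show "det (vector [B $ 2, B $ 2 - B $ 1, B $ 2 - B $ 3]) \<noteq> 0"
        using det by (simp add: det_3 algebra_simps)
    qed (simp_all add: 4 planes_def insert_commute linform_ker_diff_commute)
  qed
qed

theorem theorem1p6:
  fixes \<A> :: "'k::field_char_0 arrangement"
    and \<alpha> :: "('k ^ 3) set \<Rightarrow> 'k ^ 3"
    and m :: "('k ^ 3) set \<Rightarrow> nat"
    and F :: "nat \<Rightarrow> 'k arrangement"
  assumes "type_A3 \<A>"
    and "defining_forms \<A> \<alpha>"
    and "supersolvable_filtration \<A> 3 F"
    and "\<forall>H'\<in>F 3 - F 2. \<forall>H''\<in>F 2.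
           localization \<A> (H' \<inter> H'') = {H', H''} \<or>
           int (m H'' + 1) \<ge>
             (\<Sum>H | H \<in> F 3 - F 2 \<and> H' \<inter> H'' \<subseteq> H. int (m H + 1)) - 1"
  shows "(\<exists>\<theta>. universal_der \<A> \<alpha> m \<theta>) \<longleftrightarrow>
         (\<forall>H'\<in>F 3 - F 2. \<forall>H''\<in>F 2.
            localization \<A> (H' \<inter> H'') \<noteq> {H', H''} \<longrightarrow>
            int (m H'' + 1) =
              (\<Sum>H | H \<in> F 3 - F 2 \<and> H' \<inter> H'' \<subseteq> H. int (m H + 1)) - 1)"
proof -
  obtain B V where BV: "B ** V = mat 1" and \<A>: "\<A> = adapted_coordinates.planes B"
    and F2: "F 2 = {linform_ker (B $ 1 - B $ 2), linform_ker (B $ 2 - B $ 3), linform_ker (B $ 1 - B $ 3)}"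
    using supersolvable_obtain_coordinates[OF assms(1,3)] .
  interpret adapted_coordinates B V by unfold_locales (rule BV)
  have "F 3 = planes" using assms(3) by (simp add: supersolvable_filtration_def \<A>)
  then have diff: "F 3 - F 2 = {P 1, P 2, P 3}"
    using P_neq_R unfolding F2 planes_def by auto
  have P_mem: "P i \<in> {P 1, P 2, P 3}" for i using exhaust_3[of i] by auto
  have R_mem: "R j k \<in> F 2" if "(j, k) \<in> pairs" for j k using that by (auto simp: F2 pairs_def)
  have P_cases: "\<exists>i. H = P i" if "H \<in> {P 1, P 2, P 3}" for H using that by blast
  have R_cases: "\<exists>j k. (j, k) \<in> pairs \<and> H = R j k" if "H \<in> F 2" for H
    using that unfolding F2 pairs_cases by blast
  have ge: "m (P j) + m (P k) \<le> m (R j k)" if jk: "(j, k) \<in> pairs" for j k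
  proof -
    have "int (m (R j k) + 1) \<ge> (\<Sum>H | H \<in> {P 1, P 2, P 3} \<and> P j \<inter> R j k \<subseteq> H. int (m H + 1)) - 1"
      using assms(4) P_mem[of j] R_mem[OF jk] localization_triple[OF jk, of j]
      unfolding diff \<A> by blast
    then show ?thesis using multiplicity_bound_triple[OF jk, of j m] by simp
  qed
  have "(\<exists>\<theta>. universal_der \<A> \<alpha> m \<theta>) \<longleftrightarrow> (\<forall>(j, k)\<in>pairs. m (R j k) = m (P j) + m (P k))"
    using universal_der_exists_iff[OF assms(2)[unfolded \<A>] ge] unfolding \<A> .
  also have "\<dots> \<longleftrightarrow> (\<forall>H'\<in>F 3 - F 2. \<forall>H''\<in>F 2.
            localization \<A> (H' \<inter> H'') \<noteq> {H', H''} \<longrightarrow>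
            int (m H'' + 1) =
              (\<Sum>H | H \<in> F 3 - F 2 \<and> H' \<inter> H'' \<subseteq> H. int (m H + 1)) - 1)"
    unfolding diff
  proof (intro iffI ballI impI)
    fix H' H''
    assume eq: "\<forall>(j, k)\<in>pairs. m (R j k) = m (P j) + m (P k)"
      and H'_mem: "H' \<in> {P 1, P 2, P 3}" and H''_mem: "H'' \<in> F 2" and loc: "localization \<A> (H' \<inter> H'') \<noteq> {H', H''}"
    obtain i where i: "H' = P i" using P_cases[OF H'_mem] by blast
    obtain j k where jk: "(j, k) \<in> pairs" and H'': "H'' = R j k" using R_cases[OF H''_mem] by blast
    note H = i H''
    have i_jk: "i \<in> {j, k}"
    proof (rule ccontr)
      assume "i \<notin> {j, k}"
      from localization_double[OF jk this] show False using loc unfolding H \<A> by (rule notE[rotated])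
    qed
    show "int (m H'' + 1) = (\<Sum>H | H \<in> {P 1, P 2, P 3} \<and> H' \<inter> H'' \<subseteq> H. int (m H + 1)) - 1"
      unfolding H multiplicity_bound_triple[OF jk i_jk] using eq jk by auto
  next
    assume eq: "\<forall>H'\<in>{P 1, P 2, P 3}. \<forall>H''\<in>F 2. localization \<A> (H' \<inter> H'') \<noteq> {H', H''} \<longrightarrow>
      int (m H'' + 1) = (\<Sum>H | H \<in> {P 1, P 2, P 3} \<and> H' \<inter> H'' \<subseteq> H. int (m H + 1)) - 1"
    have "m (R j k) = m (P j) + m (P k)" if jk: "(j, k) \<in> pairs" for j k
    proof -
      have "int (m (R j k) + 1) = (\<Sum>H | H \<in> {P 1, P 2, P 3} \<and> P j \<inter> R j k \<subseteq> H. int (m H + 1)) - 1"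
        using eq P_mem[of j] R_mem[OF jk] localization_triple[OF jk, of j] unfolding \<A> by blast
      then show ?thesis using multiplicity_bound_triple[OF jk, of j m] by simp
    qed
    moreover fix x :: "3 \<times> 3"
    assume "x \<in> pairs"
    ultimately show "case x of (j, k) \<Rightarrow> m (R j k) = m (P j) + m (P k)" by (cases x) simp
  qed
  finally show ?thesis .
qed

end
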